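(* Let $k\ge 3$ and $n\ge 2k$ be integers. If $\mathcal A,\mathcal B\subset\binom{[n]}{k}$ are non-trivial cross-intersecting families, then $$|\mathcal A||\mathcal B|\le h(n,k)^2,\qquad\text{where } h(n,k)=\binom{n-1}{k-1}-\binom{n-k-1}{k-1}+1 .$$
   Context: $[n]=\{1,\dots,n\}$ and $\binom{[n]}{k}$ is the collection of all $k$-element subsets of $[n]$. A family is a star if all of its members contain a common fixed element; it is non-trivial if it is not a star. Families $\mathcal A,\mathcal B$ are cross-intersecting if $A\cap B\neq\emptyset$ for all $A\in\mathcal A$, $B\in\mathcal B$; they are non-trivial cross-intersecting if moreover neither $\mathcal A$ nor $\mathcal B$ is a star. *)

theory Defs
  imports Main "HOL-Library.Ramsey"
begin

text \<open>The empty family is vacuously a star, so a non-trivial family is nonempty.\<close>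

definition star :: "'a set set \<Rightarrow> bool" where
  "star F \<longleftrightarrow> (\<exists>x. \<forall>A\<in>F. x \<in> A)"

definition cross_intersecting :: "'a set set \<Rightarrow> 'a set set \<Rightarrow> bool" where
  "cross_intersecting F G \<longleftrightarrow> (\<forall>A\<in>F. \<forall>B\<in>G. A \<inter> B \<noteq> {})"

definition nontrivial_cross_intersecting :: "'a set set \<Rightarrow> 'a set set \<Rightarrow> bool" where
  "nontrivial_cross_intersecting F G \<longleftrightarrow>
     cross_intersecting F G \<and> \<not> star F \<and> \<not> star G"

text \<open>The difference is taken in the integers. The subtractions in the binomial arguments
  are on natural numbers; they do not truncate when \<open>1 \<le> k < n\<close>.\<close>

definition h :: "nat \<Rightarrow> nat \<Rightarrow> int" where
  "h n k = int ((n - 1) choose (k - 1)) - int ((n - k - 1) choose (k - 1)) + 1"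

end

theory Submission
  imports Defs
begin

text \<open>
  Write \<open>C = (n - 2) choose (k - 2)\<close>, \<open>N = (n - 1) choose (k - 1)\<close> and \<open>h = h n k\<close>. If one of the
  families has at most \<open>C\<close> members, a first-hit count of the sets meeting all members of a
  non-trivial family together with the log-concavity of \<open>m \<mapsto> m choose r\<close> bounds the product.
  Otherwise take a counterexample with \<open>|A| + |B|\<close> maximal and then with minimal sum of elements,
  so that every shift either fixes both families or turns one of them into a star.

  If the shift from \<open>j\<close> to \<open>i\<close> turns \<open>A\<close> into a star, every member of \<open>A\<close> meets \<open>{i, j}\<close>; sum bounds
  of Hilton--Milner type for the parts of \<open>A\<close> and \<open>B\<close> give \<open>|B| \<le> 3h + C - 3|A|\<close> and
  \<open>|A| + |B| \<le> N + h\<close>, and hence \<open>|A| |B| \<le> h\<^sup>2\<close>.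

  If both families are compressed, \<open>|A| + |B| \<le> 2h\<close>. Split them according to the trace on \<open>{1, 2}\<close>.
  The parts with different one-element traces satisfy the Hilton--Milner bound, and complementing
  the prefix up to the last balanced position maps the sets missing \<open>1\<close> and \<open>2\<close> of one family
  injectively to sets containing \<open>1\<close> and \<open>2\<close> outside the other family. This fails only if some member
  has no balanced prefix; then every member \<open>S\<close> of the other family has a prefix with
  \<open>2 |S \<inter> {1..j}| \<ge> j + 3\<close>, and such a family rules out so many sets, by a factor
  \<open>(n - k)(n - k - 1)(n - k - 2) / (k (k - 1)(k - 2))\<close> more than its size, that the sum bound
  holds again.
\<close>

section \<open>Uniform families as subsets of \<open>nsets\<close>\<close>

lemma nsets_iff: "A \<in> nsets V k \<longleftrightarrow> A \<subseteq> V \<and> finite A \<and> card A = k"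
  by (auto simp: nsets_def)

lemma nsetsD: "F \<subseteq> nsets V k \<Longrightarrow> A \<in> F \<Longrightarrow> A \<subseteq> V \<and> finite A \<and> card A = k"
  by (auto simp: nsets_iff dest!: subsetD)

lemma finite_family: "F \<subseteq> nsets V k \<Longrightarrow> finite V \<Longrightarrow> finite F"
  by (meson finite_imp_finite_nsets finite_subset)

section \<open>Shifting\<close>

definition repl :: "nat \<Rightarrow> nat \<Rightarrow> nat set \<Rightarrow> nat set" where
  "repl i j A = insert i (A - {j})"

text \<open>The Erdos-Ko-Rado shift. A set stays in place when its replacement is already present,
  so that no two members are merged.\<close>

definition shift_elt :: "nat \<Rightarrow> nat \<Rightarrow> nat set set \<Rightarrow> nat set \<Rightarrow> nat set" where
  "shift_elt i j F A = (if j \<in> A \<and> i \<notin> A \<and> repl i j A \<notin> F then repl i j A else A)"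

definition shift :: "nat \<Rightarrow> nat \<Rightarrow> nat set set \<Rightarrow> nat set set" where
  "shift i j F = shift_elt i j F ` F"

text \<open>Only replacements inside \<open>W\<close> are demanded, so that a prefix outside
  \<open>W\<close> can stay fixed while the later positions are shifted.\<close>

definition compressed :: "nat set \<Rightarrow> nat set set \<Rightarrow> bool" where
  "compressed W F \<longleftrightarrow> (\<forall>A\<in>F. \<forall>i\<in>W. \<forall>j\<in>W. i < j \<longrightarrow> j \<in> A \<longrightarrow> i \<notin> A \<longrightarrow> repl i j A \<in> F)"

definition weight :: "nat set set \<Rightarrow> nat" where
  "weight F = (\<Sum>A\<in>F. \<Sum>A)"

lemma repl_inverse: "j \<in> A \<Longrightarrow> i \<notin> A \<Longrightarrow> repl j i (repl i j A) = A"
  by (auto simp: repl_def)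

lemma card_repl: "finite A \<Longrightarrow> j \<in> A \<Longrightarrow> i \<notin> A \<Longrightarrow> card (repl i j A) = card A"
  using card_Suc_Diff1[of A j] by (simp add: repl_def)

lemma repl_nsets:
  assumes "A \<in> nsets V k" "i \<in> V" "j \<in> A" "i \<notin> A"
  shows "repl i j A \<in> nsets V k"
  using assms card_repl[of A j i] by (auto simp: nsets_iff repl_def)

text \<open>A moved set lands outside \<open>F\<close> and cannot collide with one that stays; two
  moved sets are recovered by the inverse replacement.\<close>

lemma inj_on_shift_elt: "inj_on (shift_elt i j F) F"
proof (rule inj_onI)
  fix A B assume *: "A \<in> F" "B \<in> F" "shift_elt i j F A = shift_elt i j F B"
  show "A = B"
  proof (cases "shift_elt i j F A = A \<or> shift_elt i j F B = B")
    case True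
    then show ?thesis using * unfolding shift_elt_def by (auto split: if_splits)
  next
    case False
    then have "repl i j A = repl i j B" "j \<in> A" "i \<notin> A" "j \<in> B" "i \<notin> B"
      using * unfolding shift_elt_def by (auto split: if_splits)
    then show ?thesis using repl_inverse by metis
  qed
qed

lemma card_shift: "card (shift i j F) = card F"
  unfolding shift_def by (rule card_image) (rule inj_on_shift_elt)

lemma shift_nsets: "F \<subseteq> nsets V k \<Longrightarrow> i \<in> V \<Longrightarrow> shift i j F \<subseteq> nsets V k"
  by (auto simp: shift_def shift_elt_def intro: repl_nsets)

text \<open>The mixed case: \<open>A\<close> moves and \<open>B\<close> stays. If \<open>B\<close>
  contains \<open>j\<close> but not \<open>i\<close>, it stays because \<open>repl i j B\<close> is
  already in \<open>G\<close>; \<open>A\<close> meets that set outside \<open>{i, j}\<close>, and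
  this common point survives.\<close>

lemma cross_shift_aux:
  assumes "\<forall>A\<in>F. \<forall>B\<in>G. A \<inter> B \<noteq> {}" "A \<in> F" "B \<in> G"
    and "j \<in> A" "i \<notin> A" "repl i j A \<notin> F" "\<not> (j \<in> B \<and> i \<notin> B \<and> repl i j B \<notin> G)"
  shows "repl i j A \<inter> B \<noteq> {}"
proof (cases "i \<in> B")
  case True then show ?thesis by (auto simp: repl_def)
next
  case False
  show ?thesis
  proof (cases "j \<in> B")
    case True
    then have "A \<inter> repl i j B \<noteq> {}" using assms False by blast
    then show ?thesis using assms False by (auto simp: repl_def)
  next
    case jB: False
    have "A \<inter> B \<noteq> {}" using assms by blast
    then show ?thesis using jB by (auto simp: repl_def)
  qed
qed

lemma cross_shift:
  assumes "cross_intersecting F G"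
  shows "cross_intersecting (shift i j F) (shift i j G)"
proof -
  have *: "\<forall>A\<in>F. \<forall>B\<in>G. A \<inter> B \<noteq> {}" and **: "\<forall>A\<in>G. \<forall>B\<in>F. A \<inter> B \<noteq> {}"
    using assms by (auto simp: cross_intersecting_def)
  have "shift_elt i j F A \<inter> shift_elt i j G B \<noteq> {}" if AB: "A \<in> F" "B \<in> G" for A B
  proof -
    let ?P = "j \<in> A \<and> i \<notin> A \<and> repl i j A \<notin> F"
    let ?Q = "j \<in> B \<and> i \<notin> B \<and> repl i j B \<notin> G"
    have "A \<inter> B \<noteq> {}" using AB * by blast
    moreover have "repl i j A \<inter> B \<noteq> {}" if ?P "\<not> ?Q"
      using cross_shift_aux[OF * AB] that by blast
    moreover have "repl i j B \<inter> A \<noteq> {}" if ?Q "\<not> ?P"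
      using cross_shift_aux[OF ** AB(2,1)] that by blast
    moreover have "repl i j A \<inter> repl i j B \<noteq> {}" by (auto simp: repl_def)
    ultimately show ?thesis unfolding shift_elt_def
      by (auto simp: Int_commute)
  qed
  then show ?thesis by (auto simp: cross_intersecting_def shift_def)
qed

lemma sum_repl_less:
  assumes "finite A" "j \<in> A" "i \<notin> A" "i < j"
  shows "\<Sum>(repl i j A) < \<Sum>A"
proof -
  have "\<Sum>(repl i j A) = i + \<Sum>(A - {j})" using assms by (simp add: repl_def)
  moreover have "\<Sum>A = j + \<Sum>(A - {j})" using assms by (simp add: sum.remove)
  ultimately show ?thesis using assms by simp
qed

text \<open>\<open>weight\<close> is the potential that ends the shifting: at minimal weight every
  downward shift fixes the family.\<close>

lemma weight_shift:
  assumes "i < j" "finite F" "\<And>A. A \<in> F \<Longrightarrow> finite A"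
  shows "weight (shift i j F) \<le> weight F"
    and "shift i j F \<noteq> F \<Longrightarrow> weight (shift i j F) < weight F"
proof -
  have eq: "weight (shift i j F) = (\<Sum>A\<in>F. \<Sum>(shift_elt i j F A))"
    unfolding weight_def shift_def by (subst sum.reindex[OF inj_on_shift_elt]) simp
  have le: "\<Sum>(shift_elt i j F A) \<le> \<Sum>A" if "A \<in> F" for A
    using sum_repl_less[of A j i] assms that by (auto simp: shift_elt_def)
  show "weight (shift i j F) \<le> weight F"
    unfolding eq weight_def[of F] by (intro sum_mono le)
  show "weight (shift i j F) < weight F" if "shift i j F \<noteq> F"
  proof -
    obtain A where A: "A \<in> F" "shift_elt i j F A \<noteq> A"
    proof (rule ccontr)
      assume "\<not> thesis"
      then have "\<forall>A\<in>F. shift_elt i j F A = A" using that by blast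
      then have "shift i j F = F" by (auto simp: shift_def)
      then show False using \<open>shift i j F \<noteq> F\<close> by blast
    qed
    then have "\<Sum>(shift_elt i j F A) < \<Sum>A"
      using sum_repl_less[of A j i] assms by (auto simp: shift_elt_def split: if_splits)
    then show ?thesis unfolding eq weight_def[of F]
      using A le assms(2) by (intro sum_strict_mono_ex1) auto
  qed
qed

lemma shift_fixed_imp:
  assumes "shift i j F = F" "A \<in> F" "j \<in> A" "i \<notin> A"
  shows "repl i j A \<in> F"
proof (rule ccontr)
  assume "repl i j A \<notin> F"
  then have "shift_elt i j F A = repl i j A" using assms by (simp add: shift_elt_def)
  then have "repl i j A \<in> shift i j F" using assms(2) unfolding shift_def by (metis imageI)
  then show False using assms(1) \<open>repl i j A \<notin> F\<close> by simp
qed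

lemma compressedI: "(\<And>i j. i \<in> W \<Longrightarrow> j \<in> W \<Longrightarrow> i < j \<Longrightarrow> shift i j F = F) \<Longrightarrow> compressed W F"
  using shift_fixed_imp by (auto simp: compressed_def)

lemma compressedD:
  "compressed W F \<Longrightarrow> A \<in> F \<Longrightarrow> i \<in> W \<Longrightarrow> j \<in> W \<Longrightarrow> i < j \<Longrightarrow> j \<in> A \<Longrightarrow> i \<notin> A \<Longrightarrow> repl i j A \<in> F"
  by (auto simp: compressed_def)

lemma compressed_mono: "compressed W F \<Longrightarrow> W' \<subseteq> W \<Longrightarrow> compressed W' F"
  by (auto simp: compressed_def subset_iff)

text \<open>Shifting both families at once keeps sizes and cross-intersection, so a pair of least
  total weight with these properties is fixed by all shifts.\<close>

lemma obtain_compressed: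
  assumes "finite V" "X \<subseteq> nsets V p" "Y \<subseteq> nsets V q" "cross_intersecting X Y"
  obtains X' Y' where "X' \<subseteq> nsets V p" "Y' \<subseteq> nsets V q" "cross_intersecting X' Y'"
    "card X' = card X" "card Y' = card Y" "compressed V X'" "compressed V Y'"
proof -
  let ?P = "\<lambda>(X',Y'). X' \<subseteq> nsets V p \<and> Y' \<subseteq> nsets V q \<and> cross_intersecting X' Y' \<and>
    card X' = card X \<and> card Y' = card Y"
  have "?P (X,Y)" using assms by simp
  from ex_has_least_nat[of ?P, OF this, of "\<lambda>(X,Y). weight X + weight Y"]
  obtain X' Y' where P: "?P (X',Y')"
    and least: "\<And>X'' Y''. ?P (X'',Y'') \<Longrightarrow> weight X' + weight Y' \<le> weight X'' + weight Y''"
    by auto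
  have fin: "finite X'" "finite Y'" "\<And>A. A \<in> X' \<Longrightarrow> finite A" "\<And>A. A \<in> Y' \<Longrightarrow> finite A"
    using P assms(1) finite_family by (auto simp: nsets_iff subset_iff)
  have fixed: "shift i j X' = X' \<and> shift i j Y' = Y'" if "i \<in> V" "i < j" for i j
  proof -
    have "?P (shift i j X', shift i j Y')"
      using P that by (auto simp: card_shift intro!: cross_shift dest: shift_nsets)
    from least[OF this] show ?thesis
      using weight_shift[OF that(2), of X'] weight_shift[OF that(2), of Y'] fin by fastforce
  qed
  have "compressed V X'" "compressed V Y'" using fixed by (auto intro!: compressedI)
  then show ?thesis using P that by blast
qed

text \<open>The smallest common point \<open>y\<close> is moved down to a free \<open>x < y\<close>,
  which the prefix condition at \<open>y\<close> provides. Repeating this removes all common points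
  in \<open>W\<close>.\<close>

lemma obtain_disjoint:
  assumes "compressed W F" "A \<in> F" "finite A" "finite W"
    and "\<And>i. i \<in> W \<Longrightarrow> card (A \<inter> W \<inter> {..i}) + card (B \<inter> W \<inter> {..i}) \<le> card (W \<inter> {..i})"
  shows "\<exists>A'\<in>F. A' - W = A - W \<and> A' \<inter> W \<inter> B = {}"
  using assms(2,3,5)
proof (induction "card (A \<inter> B \<inter> W)" arbitrary: A rule: less_induct)
  case less
  show ?case
  proof (cases "A \<inter> B \<inter> W = {}")
    case True
    then show ?thesis using less.prems by blast
  next
    case False
    define y where "y = Min (A \<inter> B \<inter> W)"
    have fin: "finite (A \<inter> B \<inter> W)" using less.prems by simp
    have y: "y \<in> A" "y \<in> B" "y \<in> W" using Min_in[OF fin False] by (auto simp: y_def)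
    have ymin: "z \<notin> A \<inter> B \<inter> W" if "z < y" for z
      using Min_le[OF fin, of z] that by (auto simp: y_def)
    let ?a = "\<lambda>i. A \<inter> W \<inter> {..i}" and ?b = "\<lambda>i. B \<inter> W \<inter> {..i}"
    have finW: "finite (W \<inter> S)" "finite (X \<inter> W \<inter> S)" for S X using assms(4) by auto
    have "card (?a y \<union> ?b y) + card (?a y \<inter> ?b y) = card (?a y) + card (?b y)"
      using card_Un_Int[of "?a y" "?b y"] finW by simp
    moreover have "card (?a y \<inter> ?b y) \<ge> 1"
    proof -
      have "y \<in> ?a y \<inter> ?b y" using y by auto
      then have "card (?a y \<inter> ?b y) \<noteq> 0" using finW by (subst card_0_eq) auto
      then show ?thesis by linarith
    qed
    \<comment> \<open>As \<open>y\<close> is counted twice, the union is strictly smaller than the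
      prefix of \<open>W\<close>, which leaves room for \<open>x\<close>.\<close>
    ultimately have "card (?a y \<union> ?b y) < card (W \<inter> {..y})"
      using less.prems(3)[OF y(3)] by linarith
    then have "\<not> W \<inter> {..y} \<subseteq> ?a y \<union> ?b y"
      using card_mono[of "?a y \<union> ?b y" "W \<inter> {..y}"] finW by auto
    then obtain x where x: "x \<in> W \<inter> {..y}" "x \<notin> ?a y \<union> ?b y" by blast
    have x': "x \<in> W" "x < y" "x \<notin> A" "x \<notin> B" using x y by (auto simp: order.order_iff_strict)
    let ?A = "repl x y A"
    have inF: "?A \<in> F" using assms(1) less.prems(1) x' y by (auto simp: compressed_def)
    have "?A \<inter> B \<inter> W = (A \<inter> B \<inter> W) - {y}" using x' by (auto simp: repl_def)
    then have lt: "card (?A \<inter> B \<inter> W) < card (A \<inter> B \<inter> W)"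
      using card_Diff1_less[OF fin, of y] y by simp
    have cond: "card (?A \<inter> W \<inter> {..i}) + card (?b i) \<le> card (W \<inter> {..i})" if i: "i \<in> W" for i
    proof (cases "i < x")
      case True
      then have "?A \<inter> W \<inter> {..i} = ?a i" using x' by (auto simp: repl_def)
      then show ?thesis using less.prems(3)[OF i] by simp
    next
      case ge: False
      show ?thesis
      proof (cases "i < y")
        case True
        \<comment> \<open>The count of \<open>A\<close> has grown by one here, but no common point
          lies below \<open>y\<close>, so disjointness gives the bound directly.\<close>
        have e: "?A \<inter> W \<inter> {..i} = insert x (?a i)" using x' ge True by (auto simp: repl_def)
        have "(?A \<inter> W \<inter> {..i}) \<inter> ?b i = {}" using ymin True x' unfolding e by auto
        then have "card (?A \<inter> W \<inter> {..i}) + card (?b i) = card ((?A \<inter> W \<inter> {..i}) \<union> ?b i)"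
          using finW by (intro card_Un_disjoint[symmetric]) auto
        also have "\<dots> \<le> card (W \<inter> {..i})" using finW by (intro card_mono) auto
        finally show ?thesis .
      next
        case False
        have e: "?A \<inter> W \<inter> {..i} = insert x (?a i - {y})" using x' y False by (auto simp: repl_def)
        have "card (?A \<inter> W \<inter> {..i}) = card (?a i)"
          using card_Suc_Diff1[of "?a i" y] x' y False finW unfolding e by simp
        then show ?thesis using less.prems(3)[OF i] by simp
      qed
    qed
    have "finite ?A" using less.prems(2) by (simp add: repl_def)
    from less.hyps[OF lt inF this cond] obtain A' where
      "A' \<in> F" "A' - W = ?A - W" "A' \<inter> W \<inter> B = {}" by blast
    moreover have "?A - W = A - W" using x' y by (auto simp: repl_def)
    ultimately show ?thesis by auto
  qed
qed

section \<open>Links and elementary counting\<close>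

definition link :: "nat \<Rightarrow> nat set set \<Rightarrow> nat set set" where
  "link v F = (\<lambda>A. A - {v}) ` {A \<in> F. v \<in> A}"

definition deletion :: "nat \<Rightarrow> nat set set \<Rightarrow> nat set set" where
  "deletion v F = {A \<in> F. v \<notin> A}"

lemma mem_link: "B \<in> link v F \<longleftrightarrow> v \<notin> B \<and> insert v B \<in> F"
proof -
  have "A \<in> F \<Longrightarrow> v \<in> A \<Longrightarrow> insert v (A - {v}) \<in> F" for A by (simp add: insert_absorb)
  moreover have "v \<notin> B \<Longrightarrow> insert v B \<in> F \<Longrightarrow> B \<in> link v F"
    unfolding link_def by (rule image_eqI[of _ _ "insert v B"]) auto
  ultimately show ?thesis by (auto simp: link_def)
qed

lemma card_link_eq: "card (link v F) = card {A \<in> F. v \<in> A}"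
  unfolding link_def by (rule card_image) (auto simp: inj_on_def)

lemma card_link_deletion:
  assumes "finite F"
  shows "card F = card (link v F) + card (deletion v F)"
proof -
  have "F = {A \<in> F. v \<in> A} \<union> {A \<in> F. v \<notin> A}" by blast
  then have "card F = card ({A \<in> F. v \<in> A} \<union> {A \<in> F. v \<notin> A})" by simp
  also have "\<dots> = card {A \<in> F. v \<in> A} + card {A \<in> F. v \<notin> A}"
    using assms by (intro card_Un_disjoint) auto
  finally show ?thesis by (simp add: card_link_eq deletion_def)
qed

lemma link_nsets: "F \<subseteq> nsets V k \<Longrightarrow> link v F \<subseteq> nsets (V - {v}) (k - 1)"
  by (auto simp: link_def nsets_iff subset_iff card_Diff_singleton)

lemma deletion_nsets: "F \<subseteq> nsets V k \<Longrightarrow> deletion v F \<subseteq> nsets (V - {v}) k"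
  by (auto simp: deletion_def nsets_iff subset_iff)

lemma card_meeting:
  assumes "finite V" "S \<subseteq> V"
  shows "card {T \<in> nsets V r. T \<inter> S \<noteq> {}} + ((card V - card S) choose r) = card V choose r"
proof -
  have e: "nsets V r = {T \<in> nsets V r. T \<inter> S \<noteq> {}} \<union> nsets (V - S) r"
    by (auto simp: nsets_iff)
  have "card (nsets V r) = card {T \<in> nsets V r. T \<inter> S \<noteq> {}} + card (nsets (V - S) r)"
    by (subst e, subst card_Un_disjoint)
      (use assms in \<open>auto simp: nsets_iff finite_imp_finite_nsets\<close>)
  then show ?thesis
    using assms by (simp add: card_nsets card_Diff_subset finite_subset)
qed

lemma card_meeting_le:
  assumes "finite V" "S \<subseteq> V" "Y \<subseteq> nsets V r" "\<And>T. T \<in> Y \<Longrightarrow> T \<inter> S \<noteq> {}"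
  shows "card Y + ((card V - card S) choose r) \<le> card V choose r"
proof -
  have "card Y \<le> card {T \<in> nsets V r. T \<inter> S \<noteq> {}}"
    using assms by (intro card_mono) (auto simp: finite_imp_finite_nsets)
  then show ?thesis using card_meeting[OF assms(1,2), of r] by linarith
qed

lemma card_containing:
  assumes "finite V" "S \<subseteq> V" "card S \<le> k"
  shows "card {A \<in> nsets V k. S \<subseteq> A} = (card V - card S) choose (k - card S)"
proof -
  have fS: "finite S" using assms finite_subset by blast
  have "bij_betw (\<lambda>A. A - S) {A \<in> nsets V k. S \<subseteq> A} (nsets (V - S) (k - card S))"
  proof (rule bij_betw_byWitness[where f' = "\<lambda>B. B \<union> S"])
    show "(\<lambda>A. A - S) ` {A \<in> nsets V k. S \<subseteq> A} \<subseteq> nsets (V - S) (k - card S)"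
      using fS by (auto simp: nsets_iff card_Diff_subset)
    show "(\<lambda>B. B \<union> S) ` nsets (V - S) (k - card S) \<subseteq> {A \<in> nsets V k. S \<subseteq> A}"
    proof clarify
      fix B assume B: "B \<in> nsets (V - S) (k - card S)"
      then have "card (B \<union> S) = card B + card S"
        using fS by (intro card_Un_disjoint) (auto simp: nsets_iff)
      then show "B \<union> S \<in> nsets V k \<and> S \<subseteq> B \<union> S"
        using B fS assms by (auto simp: nsets_iff)
    qed
  qed (auto simp: nsets_iff)
  from bij_betw_same_card[OF this] show ?thesis
    using assms fS by (simp add: card_nsets card_Diff_subset)
qed

section \<open>The Hilton--Milner bound for the sum of two cross-intersecting families\<close>

lemma cross_commute: "cross_intersecting F G \<longleftrightarrow> cross_intersecting G F"
  by (auto simp: cross_intersecting_def)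

lemma cross_sym: "cross_intersecting F G \<Longrightarrow> cross_intersecting G F"
  by (auto simp: cross_intersecting_def)

lemma crossD: "cross_intersecting F G \<Longrightarrow> A \<in> F \<Longrightarrow> B \<in> G \<Longrightarrow> A \<inter> B \<noteq> {}"
  by (auto simp: cross_intersecting_def)

text \<open>Complementation in a set of \<open>2 * s\<close> points keeps the size \<open>s\<close>,
  and no complement of a member of \<open>X\<close> lies in \<open>Y\<close>.\<close>

lemma cross_half:
  assumes "finite V" "card V = 2 * s" "X \<subseteq> nsets V s" "Y \<subseteq> nsets V s" "cross_intersecting X Y"
  shows "card X + card Y \<le> card V choose s"
proof -
  let ?c = "\<lambda>A. V - A"
  have inj: "inj_on ?c X" using assms(3) by (auto simp: inj_on_def nsets_iff subset_iff)
  have sub: "?c ` X \<subseteq> nsets V s"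
    using assms(1-3) by (auto simp: nsets_iff subset_iff card_Diff_subset)
  have disj: "?c ` X \<inter> Y = {}" using assms(5) by (auto simp: cross_intersecting_def)
  have "card X + card Y = card (?c ` X \<union> Y)"
    using assms sub disj inj finite_family[OF _ assms(1)]
    by (subst card_Un_disjoint) (auto simp: card_image)
  also have "\<dots> \<le> card (nsets V s)"
    using sub assms by (intro card_mono) (auto simp: finite_imp_finite_nsets)
  finally show ?thesis using assms by (simp add: card_nsets)
qed

text \<open>Two disjoint sets in the links would leave some \<open>i\<close> other than
  \<open>v\<close> uncovered; replacing the largest point \<open>v\<close> by \<open>i\<close> in
  one of the original sets makes the two disjoint.\<close>

lemma cross_link_compressed:
  assumes X: "X \<subseteq> nsets V p" and Y: "Y \<subseteq> nsets V q" and cr: "cross_intersecting X Y"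
    and V: "finite V" "v \<in> V" "\<And>i. i \<in> V \<Longrightarrow> i \<le> v" and c: "compressed V X"
    and "p + q \<le> card V" "1 \<le> p" "1 \<le> q"
  shows "cross_intersecting (link v X) (link v Y)"
proof -
  have "S \<inter> T \<noteq> {}" if S: "S \<in> link v X" and T: "T \<in> link v Y" for S T
  proof
    assume d: "S \<inter> T = {}"
    have "S \<in> nsets (V - {v}) (p - 1)" "T \<in> nsets (V - {v}) (q - 1)"
      using S T link_nsets[OF X] link_nsets[OF Y] by blast+
    then have *: "S \<subseteq> V - {v}" "finite S" "card S = p - 1" "T \<subseteq> V - {v}" "finite T" "card T = q - 1"
      by (auto simp: nsets_iff)
    have "card (S \<union> T) < card (V - {v})"
      using card_Un_le[of S T] * assms(8-10) V by simp
    then have "\<not> V - {v} \<subseteq> S \<union> T" using * card_mono[of "S \<union> T" "V - {v}"] by auto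
    then obtain i where i: "i \<in> V" "i \<noteq> v" "i \<notin> S" "i \<notin> T" by blast
    have "insert v S \<in> X" "insert v T \<in> Y" using S T mem_link by auto
    moreover have "repl i v (insert v S) \<in> X"
      using compressedD[OF c \<open>insert v S \<in> X\<close>, of i v] i V(2) V(3)[of i] by auto
    moreover have "repl i v (insert v S) \<inter> insert v T = {}"
      using * i d by (auto simp: repl_def)
    ultimately show False using cr unfolding cross_intersecting_def by blast
  qed
  then show ?thesis by (auto simp: cross_intersecting_def)
qed

lemma deletion_nonempty:
  assumes X: "X \<subseteq> nsets V p" "X \<noteq> {}" and V: "finite V" "v \<in> V" "\<And>i. i \<in> V \<Longrightarrow> i \<le> v"
    and c: "compressed V X" and "p < card V"
  shows "deletion v X \<noteq> {}"
proof -
  obtain A where A: "A \<in> X" using X by blast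
  then have A': "A \<subseteq> V" "finite A" "card A = p" using X by (auto simp: nsets_iff subset_iff)
  show ?thesis
  proof (cases "v \<in> A")
    case True
    have "\<not> V \<subseteq> A" using card_mono[of A V] A' assms(7) by auto
    then obtain i where i: "i \<in> V" "i \<notin> A" by blast
    then have "repl i v A \<in> X" using compressedD[OF c A, of i v] True V(2) V(3)[of i] by (metis le_neq_implies_less)
    moreover have "v \<notin> repl i v A" using i True by (auto simp: repl_def)
    ultimately show ?thesis by (auto simp: deletion_def)
  next
    case False
    then show ?thesis using A by (auto simp: deletion_def)
  qed
qed

text \<open>A member of \<open>X\<close> avoiding \<open>v\<close> is met by every set in the link
  of \<open>Y\<close>, which excludes all \<open>(s - 1)\<close>-subsets of its complement in
  \<open>V - {v}\<close>.\<close>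

lemma card_link_le:
  assumes Y: "Y \<subseteq> nsets V s" and cr: "cross_intersecting X Y" and V: "finite V" "v \<in> V"
    and X: "X \<subseteq> nsets V s" "deletion v X \<noteq> {}"
  shows "card (link v Y) + ((card V - 1 - s) choose (s - 1)) \<le> (card V - 1) choose (s - 1)"
proof -
  obtain A where A: "A \<in> X" "v \<notin> A" using X by (auto simp: deletion_def)
  then have A': "A \<subseteq> V - {v}" "card A = s" using X by (auto simp: nsets_iff subset_iff)
  have "card (link v Y) + ((card (V - {v}) - card A) choose (s - 1)) \<le> card (V - {v}) choose (s - 1)"
  proof (rule card_meeting_le)
    fix T assume "T \<in> link v Y"
    then have "insert v T \<in> Y" by (simp add: mem_link)
    then have "A \<inter> insert v T \<noteq> {}" using cr A unfolding cross_intersecting_def by blast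
    then show "T \<inter> A \<noteq> {}" using A by auto
  qed (use V A' link_nsets[OF Y] in auto)
  then show ?thesis using V A' by simp
qed

text \<open>Induction on the ground set: after compression the links and the deletions at the
  largest point are again cross-intersecting, and Pascal's rule adds up their bounds. The case
  \<open>card V = 2 * s\<close> is \<open>cross_half\<close>.\<close>

lemma cross_sum_bound:
  fixes V :: "nat set"
  assumes "finite V" "2 * s \<le> card V" "1 \<le> s" "X \<subseteq> nsets V s" "Y \<subseteq> nsets V s"
    and "cross_intersecting X Y" "X \<noteq> {}" "Y \<noteq> {}"
  shows "card X + card Y + ((card V - s) choose s) \<le> (card V choose s) + 1"
  using assms
proof (induction "card V" arbitrary: V s X Y)
  case 0
  then show ?case by simp
next
  case (Suc m)
  show ?case
  proof (cases "card V = 2 * s")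
    case True
    then show ?thesis using cross_half[of V s X Y] Suc.prems by simp
  next
    case False
    obtain X' Y' where X': "X' \<subseteq> nsets V s" "Y' \<subseteq> nsets V s" "cross_intersecting X' Y'"
      "card X' = card X" "card Y' = card Y" "compressed V X'" "compressed V Y'"
      using obtain_compressed[OF Suc.prems(1,4,5,6)] by metis
    have fin: "finite X" "finite Y" "finite X'" "finite Y'"
      using finite_family Suc.prems X' by blast+
    then have ne: "X' \<noteq> {}" "Y' \<noteq> {}" using X' Suc.prems by auto
    define v where "v = Max V"
    have "V \<noteq> {}" using Suc.hyps by auto
    then have v: "v \<in> V" "\<And>i. i \<in> V \<Longrightarrow> i \<le> v"
      using Suc.prems(1) by (auto simp: v_def)
    let ?V = "V - {v}"
    have cV: "card ?V = m" "finite ?V" using Suc.hyps v Suc.prems by auto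
    have m: "2 * s \<le> m" "s < card V" using False Suc.prems Suc.hyps by auto
    have dn: "deletion v X' \<noteq> {}" "deletion v Y' \<noteq> {}"
      using deletion_nonempty[OF _ _ Suc.prems(1) v] X' ne m by auto
    have cr0: "cross_intersecting (deletion v X') (deletion v Y')"
      using X' by (auto simp: cross_intersecting_def deletion_def)
    have del: "card (deletion v X') + card (deletion v Y') + ((m - s) choose s) \<le> (m choose s) + 1"
      using Suc.hyps(1)[of ?V s "deletion v X'" "deletion v Y'"] cV m Suc.prems dn cr0
        deletion_nsets X' by auto
    have crl: "cross_intersecting (link v X') (link v Y')"
      using cross_link_compressed[OF X'(1,2,3) Suc.prems(1) v X'(6)] m Suc.prems Suc.hyps(2) by simp
    have mc: "(m choose s) + (m choose (s - 1)) = card V choose s"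
      unfolding Suc.hyps(2)[symmetric] using Suc.prems(3) by (cases s) auto
    have mc': "((m - s) choose s) + ((m - s) choose (s - 1)) = (card V - s) choose s"
    proof -
      have "card V - s = Suc (m - s)" using Suc.hyps(2) m by simp
      then show ?thesis using Suc.prems(3) by (cases s) auto
    qed
    have lk: "card (link v X') + card (link v Y') + ((m - s) choose (s - 1)) \<le> m choose (s - 1)"
    proof (cases "link v X' = {} \<or> link v Y' = {}")
      case True
      have "card (link v Y') + ((m - s) choose (s - 1)) \<le> m choose (s - 1)"
        using card_link_le[OF X'(2,3) Suc.prems(1) v(1) X'(1) dn(1)] Suc.hyps(2)
        by (metis diff_Suc_1)
      moreover have "card (link v X') + ((m - s) choose (s - 1)) \<le> m choose (s - 1)"
        using card_link_le[OF X'(1) _ Suc.prems(1) v(1) X'(2) dn(2)] X'(3) Suc.hyps(2)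
        by (metis diff_Suc_1 cross_commute)
      ultimately show ?thesis using True by auto
    next
      case False
      have "s \<noteq> 1"
      proof
        assume "s = 1"
        then have "link v X' \<subseteq> {{}}"
          using link_nsets[OF X'(1), of v] by (auto simp: nsets_iff)
        then have "{} \<in> link v X'" using False by auto
        then show False using crl False by (auto simp: cross_intersecting_def)
      qed
      then obtain t where t: "s = Suc (Suc t)" using Suc.prems(3) by (metis One_nat_def Suc_le_D not0_implies_Suc)
      have "card (link v X') + card (link v Y') + ((m - (s - 1)) choose (s - 1)) \<le> (m choose (s - 1)) + 1"
        using Suc.hyps(1)[of ?V "s - 1" "link v X'" "link v Y'"] cV m t crl False
          link_nsets[OF X'(1), of v] link_nsets[OF X'(2), of v] by auto
      \<comment> \<open>The gain of one cancels the \<open>+ 1\<close> of the link bound, so that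
        only the \<open>+ 1\<close> from the deletions remains.\<close>
      moreover have "(m - (s - 1)) choose (s - 1) \<ge> ((m - s) choose (s - 1)) + 1"
      proof -
        have "m - (s - 1) = Suc (m - s)" using m t by auto
        then have "(m - (s - 1)) choose (s - 1) = ((m - s) choose t) + ((m - s) choose (s - 1))"
          using t by simp
        moreover have "(m - s) choose t \<ge> 1" using m t by (simp add: Suc_leI)
        ultimately show ?thesis by linarith
      qed
      ultimately show ?thesis by linarith
    qed
    have "card X = card (link v X') + card (deletion v X')"
      "card Y = card (link v Y') + card (deletion v Y')"
      using card_link_deletion fin X' by metis+
    then show ?thesis using del lk mc mc' by linarith
  qed
qed

section \<open>Initial segments\<close>

definition count :: "nat set \<Rightarrow> nat \<Rightarrow> nat" where
  "count A j = card (A \<inter> {1..j})"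

lemma count_0 [simp]: "count A 0 = 0"
  by (simp add: count_def)

lemma count_Suc: "count A (Suc j) = count A j + (if Suc j \<in> A then 1 else 0)"
proof -
  have "A \<inter> {1..Suc j} = (if Suc j \<in> A then insert (Suc j) (A \<inter> {1..j}) else A \<inter> {1..j})"
    by (auto simp: le_Suc_eq)
  then show ?thesis by (simp add: count_def)
qed

lemma count_mono: "i \<le> j \<Longrightarrow> count A i \<le> count A j"
  by (auto simp: count_def intro!: card_mono)

lemma count_full: "A \<in> nsets {1..n} k \<Longrightarrow> count A n = k"
  by (auto simp: count_def nsets_iff Int_absorb2)

lemma count_tail:
  assumes "t \<le> i"
  shows "count A i = count A t + card (A \<inter> {t<..i})"
proof -
  have "A \<inter> {1..i} = (A \<inter> {1..t}) \<union> (A \<inter> {t<..i})" using assms by auto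
  then show ?thesis unfolding count_def by (simp add: card_Un_disjoint disjoint_iff)
qed

lemma count_complement:
  assumes "G \<inter> {1..t} = {1..t} - A" "i \<le> t"
  shows "count G i + count A i = i"
proof -
  have "G \<inter> {1..i} = (G \<inter> {1..t}) \<inter> {1..i}" using assms(2) by auto
  also have "\<dots> = {1..i} - (A \<inter> {1..i})" unfolding assms(1) using assms(2) by auto
  finally have "G \<inter> {1..i} = {1..i} - (A \<inter> {1..i})" .
  then have "count G i = i - count A i"
    unfolding count_def by (simp add: card_Diff_subset)
  moreover have "count A i \<le> i"
    using card_mono[of "{1..i}" "A \<inter> {1..i}"] by (simp add: count_def)
  ultimately show ?thesis by simp
qed

lemma count_window:
  assumes "A \<subseteq> {1..n}" "1 \<le> a" "a \<le> i" "i \<le> n"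
  shows "card (A \<inter> {a..n} \<inter> {..i}) + count A (a - 1) = count A i"
proof -
  have "A \<inter> {a..n} \<inter> {..i} = A \<inter> {a - 1<..i}" using assms by auto
  then show ?thesis using count_tail[of "a - 1" i A] assms by simp
qed

lemma card_window: "1 \<le> a \<Longrightarrow> a \<le> i \<Longrightarrow> i \<le> n \<Longrightarrow> card ({a..n} \<inter> {..i}) + (a - 1) = (i::nat)"
proof -
  assume "1 \<le> a" "a \<le> i" "i \<le> n"
  moreover from this have "{a..n} \<inter> {..i} = {a..i}" by auto
  ultimately show ?thesis by simp
qed

text \<open>Contrapositive of \<open>obtain_disjoint\<close> with \<open>W = {a..n}\<close>. Below
  \<open>a\<close> one set is full and the other empty, so counting from \<open>1\<close> instead of
  from \<open>a\<close> adds \<open>a - 1\<close> to both sides.\<close>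

lemma compressed_crossing:
  assumes "compressed {a..n} F" "1 \<le> a" "A \<in> F" "A \<subseteq> {1..n}" "B \<subseteq> {1..n}"
    and "{1..<a} \<subseteq> A" "B \<inter> {1..<a} = {}" "\<And>A'. A' \<in> F \<Longrightarrow> A' \<inter> B \<noteq> {}"
  shows "\<exists>i\<in>{a..n}. i < count A i + count B i"
proof (rule ccontr)
  assume no: "\<not> ?thesis"
  have cA: "count A (a - 1) = a - 1"
  proof -
    have "{1..a - 1} = {1..<a}" using assms(2) by auto
    then have "A \<inter> {1..a - 1} = {1..a - 1}" using assms(6) by blast
    then show ?thesis by (simp add: count_def)
  qed
  have cB: "count B (a - 1) = 0"
  proof -
    have "{1..a - 1} = {1..<a}" using assms(2) by auto
    then have "B \<inter> {1..a - 1} = {}" using assms(7) by simp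
    then show ?thesis by (simp add: count_def)
  qed
  have "\<exists>A'\<in>F. A' - {a..n} = A - {a..n} \<and> A' \<inter> {a..n} \<inter> B = {}"
  proof (rule obtain_disjoint)
    show "finite A" using assms(4) finite_subset by blast
    fix i assume i: "i \<in> {a..n}"
    then have "count A i + count B i \<le> i" using no by (meson not_le)
    then show "card (A \<inter> {a..n} \<inter> {..i}) + card (B \<inter> {a..n} \<inter> {..i}) \<le> card ({a..n} \<inter> {..i})"
      using count_window[OF assms(4,2), of i] count_window[OF assms(5,2), of i]
        card_window[OF assms(2), of i n] i cA cB by auto
  qed (use assms in auto)
  then obtain A' where "A' \<in> F" "A' \<inter> {a..n} \<inter> B = {}" by blast
  moreover have "B \<subseteq> {a..n}"
  proof
    fix x assume "x \<in> B"
    then have "x \<in> {1..n}" "x \<notin> {1..<a}" using assms(5,7) by blast+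
    then show "x \<in> {a..n}" by auto
  qed
  ultimately show False using assms(8)[of A'] by blast
qed

section \<open>Reflecting at the last balanced prefix\<close>

text \<open>Beyond the last balanced position a set stays sparse, so that there it can be shifted away from
  itself; this would be false for the first balanced position.\<close>

definition balance :: "nat \<Rightarrow> nat set \<Rightarrow> nat" where
  "balance n B = Max {j \<in> {1..n}. j \<le> 2 * count B j}"

definition reflect :: "nat \<Rightarrow> nat set \<Rightarrow> nat set" where
  "reflect n B = ({1..balance n B} - B) \<union> (B - {1..balance n B})"

text \<open>Equality at the last position holds because the next position already fails, or, at
  position \<open>n\<close>, because \<open>2 * k \<le> n\<close>.\<close>

lemma balance_props:
  assumes "B \<in> nsets {1..n} k" "2 * k \<le> n" "\<exists>j\<in>{1..n}. j \<le> 2 * count B j"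
  shows "1 \<le> balance n B" "balance n B \<le> n" "2 * count B (balance n B) = balance n B"
    and "\<And>i. balance n B < i \<Longrightarrow> i \<le> n \<Longrightarrow> 2 * count B i < i"
proof -
  let ?S = "{j \<in> {1..n}. j \<le> 2 * count B j}"
  let ?t = "balance n B"
  have "?t \<in> ?S" unfolding balance_def using assms(3) by (intro Max_in) auto
  then have le: "?t \<le> 2 * count B ?t" by simp
  show t: "1 \<le> ?t" "?t \<le> n" using \<open>?t \<in> ?S\<close> by auto
  show gt: "2 * count B i < i" if "?t < i" "i \<le> n" for i
  proof (rule ccontr)
    assume "\<not> ?thesis"
    then have "i \<in> ?S" using that by auto
    then have "i \<le> ?t" unfolding balance_def by (intro Max_ge) auto
    then show False using that by simp
  qed
  show "2 * count B ?t = ?t"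
  proof (cases "?t = n")
    case True
    then show ?thesis using le assms(1,2) count_full by fastforce
  next
    case False
    then have "2 * count B (Suc ?t) < Suc ?t" using t gt by simp
    then show ?thesis using le by (simp add: count_Suc split: if_splits)
  qed
qed

text \<open>A balanced prefix has as many points inside the set as outside, so complementing it
  changes neither the later counts nor the size. The last balanced position is preserved as well,
  which makes \<open>reflect\<close> an involution.\<close>

lemma reflect_props:
  assumes "B \<in> nsets {1..n} k" "2 * k \<le> n" "\<exists>j\<in>{1..n}. j \<le> 2 * count B j"
  defines "t \<equiv> balance n B"
  shows "i \<le> t \<Longrightarrow> count (reflect n B) i + count B i = i"
    and "t \<le> i \<Longrightarrow> count (reflect n B) i = count B i"
    and "reflect n B \<in> nsets {1..n} k" "balance n (reflect n B) = t"
    and "reflect n (reflect n B) = B"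
proof -
  note b = balance_props[OF assms(1-3), folded t_def]
  have B: "B \<subseteq> {1..n}" using assms(1) by (auto simp: nsets_iff)
  have pre: "reflect n B \<inter> {1..t} = {1..t} - B" by (auto simp: reflect_def t_def)
  show c1: "count (reflect n B) i + count B i = i" if "i \<le> t" for i
    using count_complement[OF pre that] .
  show c2: "count (reflect n B) i = count B i" if "t \<le> i" for i
  proof -
    have "reflect n B \<inter> {t<..i} = B \<inter> {t<..i}" by (auto simp: reflect_def t_def)
    then show ?thesis
      using c1[of t] b(3) count_tail[OF that, of B] count_tail[OF that, of "reflect n B"] by simp
  qed
  have sub: "reflect n B \<subseteq> {1..n}" using B b(2) by (auto simp: reflect_def t_def)
  have "card (reflect n B) = k"
    using c2[OF b(2)] count_full[OF assms(1)] sub by (simp add: count_def Int_absorb2)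
  then show "reflect n B \<in> nsets {1..n} k"
    using sub finite_subset by (auto simp: nsets_iff)
  show bal: "balance n (reflect n B) = t"
    unfolding balance_def
  proof (rule Max_eqI)
    show "t \<in> {j \<in> {1..n}. j \<le> 2 * count (reflect n B) j}" using b c1[of t] by auto
    fix i assume i: "i \<in> {j \<in> {1..n}. j \<le> 2 * count (reflect n B) j}"
    show "i \<le> t"
    proof (rule ccontr)
      assume "\<not> i \<le> t"
      then show False using i b(4)[of i] c2[of i] by auto
    qed
  qed auto
  show "reflect n (reflect n B) = B"
    unfolding reflect_def[of n "reflect n B"] bal using B by (auto simp: reflect_def t_def)
qed

text \<open>The reflections contain \<open>1\<close> and \<open>2\<close> and lie outside
  \<open>F\<close>: the counts of \<open>B\<close> and of its reflection add up to \<open>i\<close>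
  within the reflected prefix and to less than \<open>i\<close> beyond it, so there is no crossing
  position.\<close>

lemma reflection_bound:
  assumes "2 * k \<le> n" "2 \<le> k" "F \<subseteq> nsets {1..n} k" "G \<subseteq> nsets {1..n} k"
    and "cross_intersecting F G" "compressed {3..n} F"
    and hit: "\<And>B. B \<in> G \<Longrightarrow> 1 \<notin> B \<Longrightarrow> 2 \<notin> B \<Longrightarrow> \<exists>j\<in>{1..n}. j \<le> 2 * count B j"
  shows "card {A \<in> F. 1 \<in> A \<and> 2 \<in> A} + card {B \<in> G. 1 \<notin> B \<and> 2 \<notin> B} \<le> (n - 2) choose (k - 2)"
proof -
  let ?F = "{A \<in> F. 1 \<in> A \<and> 2 \<in> A}" and ?G = "{B \<in> G. 1 \<notin> B \<and> 2 \<notin> B}"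
  have "inj_on (reflect n) ?G"
    using reflect_props(5)[OF _ assms(1)] hit assms(4)
    by (intro inj_on_inverseI[where g = "reflect n"]) auto
  moreover have img: "reflect n B \<in> nsets {1..n} k \<and> {1,2} \<subseteq> reflect n B \<and> reflect n B \<notin> F"
    if B: "B \<in> ?G" for B
  proof -
    have Bn: "B \<in> nsets {1..n} k" and h: "\<exists>j\<in>{1..n}. j \<le> 2 * count B j"
      using B assms(4) hit by auto
    note b = balance_props[OF Bn assms(1) h] and r = reflect_props[OF Bn assms(1) h]
    have "count B 1 = 0" "count B 2 = 0"
      using B by (auto simp: count_Suc numeral_2_eq_2)
    \<comment> \<open>Nothing is counted up to \<open>2\<close>, so the balanced prefix extends past
      \<open>2\<close> and reflection puts both points in.\<close>
    then have "balance n B \<noteq> 1" "balance n B \<noteq> 2" using b(3) by fastforce+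
    then have t: "3 \<le> balance n B" using b(1) by simp
    then have sub: "{1,2} \<subseteq> reflect n B" using B by (auto simp: reflect_def)
    have "reflect n B \<notin> F"
    proof
      assume R: "reflect n B \<in> F"
      have "{1..<3} = {1,2::nat}" by auto
      then have "\<exists>i\<in>{3..n}. i < count (reflect n B) i + count B i"
        using B Bn r(3) R sub assms(5,6)
        by (intro compressed_crossing[of 3 n F])
          (auto simp: cross_intersecting_def nsets_iff)
      then obtain i where i: "i \<in> {3..n}" "i < count (reflect n B) i + count B i" by blast
      show False
      proof (cases "i \<le> balance n B")
        case True
        then show False using r(1)[of i] i by simp
      next
        case False
        then show False using r(2)[of i] b(4)[of i] i by simp
      qed
    qed
    then show ?thesis using r sub by blast
  qed
  ultimately have "card ?F + card ?G = card (?F \<union> reflect n ` ?G)"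
    using finite_family[OF assms(3)] finite_family[OF assms(4)] by (subst card_Un_disjoint) (auto simp: card_image)
  also have "\<dots> \<le> card {A \<in> nsets {1..n} k. {1,2} \<subseteq> A}"
    using img assms(3) by (intro card_mono) (auto simp: finite_imp_finite_nsets)
  also have "\<dots> = (n - 2) choose (k - 2)"
    using card_containing[of "{1..n}" "{1,2}" k] assms(1,2) by (simp add: numeral_2_eq_2)
  finally show ?thesis .
qed

text \<open>At a crossing position \<open>i\<close> the counts sum to at least \<open>i + 1\<close>,
  while twice the count of \<open>B\<close> is at most \<open>i - 1\<close>; this leaves at least
  \<open>i + 3\<close> for twice the count of \<open>A\<close>.\<close>

lemma compressed_hits:
  assumes "compressed {a..n} F" "1 \<le> a" "A \<in> F" "A \<subseteq> {1..n}" "B \<subseteq> {1..n}"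
    and "{1..<a} \<subseteq> A" "B \<inter> {1..<a} = {}" "\<And>A'. A' \<in> F \<Longrightarrow> A' \<inter> B \<noteq> {}"
    and "\<And>j. j \<in> {1..n} \<Longrightarrow> 2 * count B j < j"
  shows "\<exists>j\<in>{1..n}. j + 3 \<le> 2 * count A j"
proof -
  obtain i where i: "i \<in> {a..n}" "i < count A i + count B i"
    using compressed_crossing[OF assms(1-8)] by blast
  then have "2 * count B i < i" using assms(2) by (intro assms(9)) auto
  then have "i + 3 \<le> 2 * count A i" using i by linarith
  then show ?thesis using i assms(2) by (intro bexI[of _ i]) auto
qed

section \<open>Families with a large excess\<close>

text \<open>The excess \<open>2 |A \<inter> {1..j}| - j\<close> changes by one in each step; \<open>hits A u\<close> says that it first reaches
  \<open>3\<close> at \<open>j = 2 u + 3\<close>, and \<open>cohits G u\<close> that it first reaches \<open>-3\<close> there.\<close>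

definition hits :: "nat set \<Rightarrow> nat \<Rightarrow> bool" where
  "hits A u \<longleftrightarrow> count A (2 * u + 3) = u + 3 \<and> (\<forall>j < 2 * u + 3. 2 * count A j < j + 3)"

definition cohits :: "nat set \<Rightarrow> nat \<Rightarrow> bool" where
  "cohits G u \<longleftrightarrow> count G (2 * u + 3) = u \<and> (\<forall>j < 2 * u + 3. j < 2 * count G j + 3)"

lemma cohits_unique:
  assumes "cohits A u" "cohits A u'"
  shows "u = u'"
proof (rule ccontr)
  have *: False if "cohits A u" "cohits A u'" "u' < u" for u u'
  proof -
    have "2 * u' + 3 < 2 * u + 3" using that(3) by simp
    then have "2 * u' + 3 < 2 * count A (2 * u' + 3) + 3"
      using that(1) unfolding cohits_def by blast
    then show False using that(2) unfolding cohits_def by simp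
  qed
  assume "u \<noteq> u'"
  then show False using *[of u u'] *[of u' u] assms by linarith
qed

text \<open>The excess moves in unit steps, so at the first position where it is at least
  \<open>3\<close> it equals \<open>3\<close>; that position is then odd.\<close>

lemma hits_exists:
  assumes "j \<le> n" "j + 3 \<le> 2 * count A j"
  shows "\<exists>u. hits A u \<and> 2 * u + 3 \<le> n"
proof -
  define t where "t = (LEAST j. j + 3 \<le> 2 * count A j)"
  have t: "t + 3 \<le> 2 * count A t" unfolding t_def using assms(2) by (rule LeastI)
  have min: "2 * count A i < i + 3" if "i < t" for i
    using not_less_Least[of i "\<lambda>j. j + 3 \<le> 2 * count A j"] that by (auto simp: t_def)
  have "t \<le> j" unfolding t_def using assms(2) by (rule Least_le)
  have "t \<noteq> 0" using t by (intro notI) simp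
  then obtain s where s: "t = Suc s" by (cases t) auto
  have eq: "2 * count A t = t + 3"
    using t min[of s] unfolding s by (auto simp: count_Suc split: if_splits)
  define u where "u = count A t - 3"
  \<comment> \<open>This yields \<open>count A t \<ge> 3\<close>, so that the subtraction in
    \<open>u\<close> does not truncate.\<close>
  have "t \<ge> 3"
  proof -
    have "count A t \<le> t"
      using card_mono[of "{1..t}" "A \<inter> {1..t}"] by (simp add: count_def)
    then show ?thesis using eq by simp
  qed
  then have "count A t = u + 3" "t = 2 * u + 3" using eq by (auto simp: u_def)
  then show ?thesis using min \<open>t \<le> j\<close> assms(1) by (auto simp: hits_def intro!: exI[of _ u])
qed

lemma binomial_absorb3:
  assumes "3 \<le> r" "r \<le> m"
  shows "(m choose r) * (r * (r - 1) * (r - 2)) = (m * (m - 1) * (m - 2)) * ((m - 3) choose (r - 3))"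
proof -
  define a b where "a = r - 3" and "b = m - 3"
  have a: "r = Suc (Suc (Suc a))" and b: "m = Suc (Suc (Suc b))"
    using assms by (simp_all add: a_def b_def)
  have 1: "Suc (Suc (Suc a)) * (m choose r) = m * (Suc (Suc b) choose Suc (Suc a))"
    unfolding a b by (rule Suc_times_binomial)
  have 2: "Suc (Suc a) * (Suc (Suc b) choose Suc (Suc a)) = Suc (Suc b) * (Suc b choose Suc a)"
    by (rule Suc_times_binomial)
  have 3: "Suc a * (Suc b choose Suc a) = Suc b * (b choose a)"
    by (rule Suc_times_binomial)
  have "(m choose r) * (r * (r - 1) * (r - 2)) = (Suc (Suc (Suc a)) * (m choose r)) * (Suc (Suc a) * Suc a)"
    unfolding a by (simp add: algebra_simps)
  also have "\<dots> = m * (Suc (Suc a) * (Suc (Suc b) choose Suc (Suc a))) * Suc a"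
    unfolding 1 by (simp only: ac_simps)
  also have "\<dots> = m * Suc (Suc b) * (Suc a * (Suc b choose Suc a))"
    unfolding 2 by (simp only: ac_simps)
  also have "\<dots> = m * Suc (Suc b) * Suc b * (b choose a)" unfolding 3 by (simp only: ac_simps)
  finally show ?thesis unfolding a b by simp
qed

section \<open>Double counting between sets with a given first hit and their partners\<close>

context
  fixes n k u :: nat
begin

text \<open>The edges of the bipartite graph for the double count: complements of each other on the
  prefix of length \<open>2 * u + 3\<close>, merely disjoint beyond it.\<close>

definition partners :: "nat set \<Rightarrow> nat set \<Rightarrow> bool" where
  "partners A G \<longleftrightarrow> A \<inter> G = {} \<and> {1..2 * u + 3} \<subseteq> A \<union> G"

lemma partners_cohits:
  assumes "partners A G" "hits A u"
  shows "cohits G u"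
proof -
  have "G \<inter> {1..2 * u + 3} = {1..2 * u + 3} - A" using assms(1) unfolding partners_def by blast
  from count_complement[OF this]
  have c: "count G j + count A j = j" if "j \<le> 2 * u + 3" for j using that by blast
  have "j < 2 * count G j + 3" if "j < 2 * u + 3" for j
  proof -
    have "2 * count A j < j + 3" using assms(2) that by (simp add: hits_def)
    then show ?thesis using c[of j] that by linarith
  qed
  then show ?thesis using c[of "2 * u + 3"] assms(2) by (auto simp: cohits_def hits_def)
qed

lemma card_suffix:
  assumes "A \<in> nsets {1..n} k" "2 * u + 3 \<le> n"
  shows "card (A - {1..2 * u + 3}) = k - count A (2 * u + 3)"
    and "card ({2 * u + 3<..n} - A) = n - (2 * u + 3) - (k - count A (2 * u + 3))"
proof -
  have fin: "finite A" "A \<subseteq> {1..n}" using assms by (auto simp: nsets_iff)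
  have "card (A - {1..2 * u + 3}) = card A - card (A \<inter> {1..2 * u + 3})"
    by (rule card_Diff_subset_Int) simp
  then show 1: "card (A - {1..2 * u + 3}) = k - count A (2 * u + 3)"
    using assms by (simp add: count_def nsets_iff)
  have "{2 * u + 3<..n} - A = {2 * u + 3<..n} - (A - {1..2 * u + 3})" by auto
  moreover have "A - {1..2 * u + 3} \<subseteq> {2 * u + 3<..n}" using fin by force
  ultimately show "card ({2 * u + 3<..n} - A) = n - (2 * u + 3) - (k - count A (2 * u + 3))"
    using 1 fin by (simp add: card_Diff_subset)
qed

text \<open>The prefix of a partner is forced and has \<open>u\<close> points; the other
  \<open>k - u\<close> are free among the \<open>n - k - u\<close> later points outside
  \<open>A\<close>.\<close>

lemma card_partners_ge:
  assumes A: "A \<in> nsets {1..n} k" "hits A u" "2 * u + 3 \<le> n" "u + 3 \<le> k"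
    and E: "finite E" "\<And>G. G \<in> nsets {1..n} k \<Longrightarrow> A \<inter> G = {} \<Longrightarrow> G \<in> E"
  shows "(n - k - u) choose (k - u) \<le> card {G \<in> E. partners A G}"
proof -
  let ?t = "2 * u + 3" let ?P = "{1..2 * u + 3} - A"
  have cA: "count A ?t = u + 3" using A by (simp add: hits_def)
  have cP: "card ?P = u"
  proof -
    have "card ?P = card {1..?t} - card (A \<inter> {1..?t})"
      by (metis Int_commute card_Diff_subset_Int finite_Int finite_atLeastAtMost)
    then show ?thesis using cA by (simp add: count_def)
  qed
  have "card ({?t<..n} - A) = n - k - u"
    using card_suffix(2)[OF A(1,3)] cA A(3,4) by simp
  then have "(n - k - u) choose (k - u) = card (nsets ({?t<..n} - A) (k - u))"
    by (simp add: card_nsets)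
  also have "\<dots> = card ((\<lambda>T. ?P \<union> T) ` nsets ({?t<..n} - A) (k - u))"
  proof (rule card_image[symmetric], rule inj_onI)
    fix S T assume *: "S \<in> nsets ({?t<..n} - A) (k - u)" "T \<in> nsets ({?t<..n} - A) (k - u)"
      "?P \<union> S = ?P \<union> T"
    have d: "?P \<inter> {?t<..n} = {}" by auto
    have "S = (?P \<union> S) - ?P" "T = (?P \<union> T) - ?P" using * d by (auto simp: nsets_iff)
    then show "S = T" using *(3) by simp
  qed
  also have "\<dots> \<le> card {G \<in> E. partners A G}"
  proof (rule card_mono)
    show "(\<lambda>T. ?P \<union> T) ` nsets ({?t<..n} - A) (k - u) \<subseteq> {G \<in> E. partners A G}"
    proof clarify
      fix T assume T: "T \<in> nsets ({?t<..n} - A) (k - u)"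
      then have T': "T \<subseteq> {?t<..n} - A" "finite T" "card T = k - u" by (auto simp: nsets_iff)
      then have "card (?P \<union> T) = u + (k - u)"
        using cP by (subst card_Un_disjoint) auto
      moreover have "?P \<union> T \<subseteq> {1..n}" using T' A(3) by auto
      ultimately have "?P \<union> T \<in> nsets {1..n} k" using T' A(4) by (auto simp: nsets_iff)
      moreover have "A \<inter> (?P \<union> T) = {}" using T' by auto
      ultimately show "?P \<union> T \<in> E \<and> partners A (?P \<union> T)"
        using E(2) by (auto simp: partners_def)
    qed
  qed (use E in simp)
  finally show ?thesis .
qed

text \<open>The prefix of a partner of \<open>G\<close> is forced and has \<open>u + 3\<close>
  points; the other \<open>k - u - 3\<close> lie among the \<open>n - k - u - 3\<close> later points
  outside \<open>G\<close>.\<close>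

lemma card_partners_le:
  assumes G: "G \<in> nsets {1..n} k" "cohits G u" "2 * u + 3 \<le> n" "u + 3 \<le> k"
    and F: "F \<subseteq> nsets {1..n} k" "\<And>A. A \<in> F \<Longrightarrow> hits A u"
  shows "card {A \<in> F. partners A G} \<le> (n - k - u - 3) choose (k - u - 3)"
proof -
  let ?t = "2 * u + 3"
  have cG: "count G ?t = u" using G by (simp add: cohits_def)
  have "card ({?t<..n} - G) = n - k - u - 3"
    using card_suffix(2)[OF G(1,3)] cG G(3,4) by simp
  then have c: "card (nsets ({?t<..n} - G) (k - u - 3)) = (n - k - u - 3) choose (k - u - 3)"
    by (simp add: card_nsets)
  have "card {A \<in> F. partners A G} \<le> card (nsets ({?t<..n} - G) (k - u - 3))"
  proof (rule card_inj_on_le[where f = "\<lambda>A. A - {1..?t}"])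
    show "inj_on (\<lambda>A. A - {1..?t}) {A \<in> F. partners A G}"
    proof (rule inj_onI)
      fix A B assume *: "A \<in> {A \<in> F. partners A G}" "B \<in> {A \<in> F. partners A G}"
        "A - {1..?t} = B - {1..?t}"
      then have "A \<inter> {1..?t} = {1..?t} - G" "B \<inter> {1..?t} = {1..?t} - G"
        unfolding partners_def by blast+
      then show "A = B" using *(3) by blast
    qed
    show "(\<lambda>A. A - {1..?t}) ` {A \<in> F. partners A G} \<subseteq> nsets ({?t<..n} - G) (k - u - 3)"
    proof clarify
      fix A assume A: "A \<in> F" "partners A G"
      then have An: "A \<in> nsets {1..n} k" and "count A ?t = u + 3"
        using F by (auto simp: hits_def)
      then have "card (A - {1..?t}) = k - u - 3" using card_suffix(1)[OF An G(3)] by simp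
      moreover have "A - {1..?t} \<subseteq> {?t<..n} - G"
        using An A(2) by (auto simp: nsets_iff partners_def subset_iff)
      ultimately show "A - {1..?t} \<in> nsets ({?t<..n} - G) (k - u - 3)"
        using An by (auto simp: nsets_iff)
    qed
  qed (simp add: finite_imp_finite_nsets)
  then show ?thesis using c by simp
qed

text \<open>Counting partner pairs from both sides compares the cardinalities with the ratio of the
  two degrees, which by \<open>binomial_absorb3\<close> is \<open>M / R\<close>. This ratio is least
  for \<open>u = 0\<close>, where it is the stated one.\<close>

lemma card_hits_le:
  assumes "2 * k \<le> n" "2 * u + 3 \<le> n" and F: "F \<subseteq> nsets {1..n} k" "\<And>A. A \<in> F \<Longrightarrow> hits A u"
    and E: "E \<subseteq> nsets {1..n} k" "\<And>G A. G \<in> nsets {1..n} k \<Longrightarrow> A \<in> F \<Longrightarrow> A \<inter> G = {} \<Longrightarrow> G \<in> E"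
  shows "((n - k) * (n - k - 1) * (n - k - 2)) * card F
    \<le> (k * (k - 1) * (k - 2)) * card {G \<in> E. cohits G u}"
proof (cases "F = {}")
  case False
  then obtain A0 where A0: "A0 \<in> F" by blast
  have uk: "u + 3 \<le> k"
  proof -
    have "count A0 (2 * u + 3) \<le> count A0 n" by (rule count_mono) (use assms in simp)
    then show ?thesis using F A0 count_full[of A0 n k] by (auto simp: hits_def)
  qed
  define m where "m = n - k - u"
  define r where "r = k - u"
  have rm: "3 \<le> r" "r \<le> m" using uk assms(1) by (auto simp: r_def m_def)
  let ?E = "{G \<in> E. cohits G u}"
  have finE: "finite E" and finF: "finite F" using finite_family[OF E(1)] finite_family[OF F(1)] by auto
  have "card F * (m choose r) = (\<Sum>A\<in>F. m choose r)" by simp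
  also have "\<dots> \<le> (\<Sum>A\<in>F. card {G \<in> ?E. partners A G})"
  proof (rule sum_mono)
    fix A assume A: "A \<in> F"
    have "m choose r \<le> card {G \<in> E. partners A G}"
      unfolding m_def r_def using A F E uk assms(2) finE by (intro card_partners_ge) auto
    also have "{G \<in> E. partners A G} = {G \<in> ?E. partners A G}"
      using partners_cohits A F(2) by blast
    finally show "m choose r \<le> card {G \<in> ?E. partners A G}" .
  qed
  also have "\<dots> = (\<Sum>G\<in>?E. card {A \<in> F. partners A G})"
    by (rule sum_multicount_gen) (use finE finF in auto)
  also have "\<dots> \<le> (\<Sum>G\<in>?E. (m - 3) choose (r - 3))"
    unfolding m_def r_def using F E uk assms(2) by (intro sum_mono card_partners_le) auto
  finally have main: "card F * (m choose r) \<le> card ?E * ((m - 3) choose (r - 3))" by simp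
  define R M where "R = r * (r - 1) * (r - 2)" and "M = m * (m - 1) * (m - 2)"
  have pos: "(m - 3) choose (r - 3) > 0" "R > 0" using rm by (auto simp: R_def)
  have "card F * M * ((m - 3) choose (r - 3)) = card F * (m choose r) * R"
    using binomial_absorb3[OF rm] by (simp add: R_def M_def)
  also have "\<dots> \<le> card ?E * R * ((m - 3) choose (r - 3))"
    using mult_le_mono1[OF main, of R] by (simp add: ac_simps)
  finally have FM: "card F * M \<le> card ?E * R" using pos by simp
  let ?U = "(n - k) * (n - k - 1) * (n - k - 2)" and ?L = "k * (k - 1) * (k - 2)"
  \<comment> \<open>Subtracting \<open>u\<close> from the numerator and the denominator of a
    fraction that is at least one does not decrease it.\<close>
  have step: "(n - k - i) * (r - i) \<le> (k - i) * (m - i)" if "i \<le> 2" for i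
  proof -
    define a b where "a = r - i" and "b = m - r"
    have a: "r = a + i" and b: "m = r + b" using rm that by (simp_all add: a_def b_def)
    have "k = a + i + u" using a uk by (simp add: r_def)
    moreover have "n - k = a + i + b + u" using a b uk assms(1) by (simp add: r_def m_def)
    ultimately show ?thesis using a b by (simp add: algebra_simps)
  qed
  have "?U * R = ((n - k - 0) * (r - 0)) * ((n - k - 1) * (r - 1)) * ((n - k - 2) * (r - 2))"
    by (simp add: R_def ac_simps)
  also have "\<dots> \<le> ((k - 0) * (m - 0)) * ((k - 1) * (m - 1)) * ((k - 2) * (m - 2))"
    by (intro mult_le_mono step) auto
  also have "\<dots> = ?L * M" by (simp add: M_def ac_simps)
  finally have UR: "?U * R \<le> ?L * M" .
  have "(?U * card F) * R \<le> (?L * M) * card F"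
    using mult_le_mono1[OF UR, of "card F"] by (simp add: ac_simps)
  also have "\<dots> \<le> (?L * card ?E) * R"
    using mult_le_mono2[OF FM, of ?L] by (simp add: ac_simps)
  finally show ?thesis using pos by simp
qed simp

end

text \<open>Sum of \<open>card_hits_le\<close> over all \<open>u\<close>: the hit classes cover
  \<open>F\<close>, and the cohit classes inside \<open>E\<close> are disjoint because a first
  passage is unique.\<close>

lemma excess_family_bound:
  assumes "2 * k \<le> n" and F: "F \<subseteq> nsets {1..n} k" "\<And>A. A \<in> F \<Longrightarrow> \<exists>j\<in>{1..n}. j + 3 \<le> 2 * count A j"
    and E: "E \<subseteq> nsets {1..n} k" "\<And>G A. G \<in> nsets {1..n} k \<Longrightarrow> A \<in> F \<Longrightarrow> A \<inter> G = {} \<Longrightarrow> G \<in> E"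
  shows "((n - k) * (n - k - 1) * (n - k - 2)) * card F \<le> (k * (k - 1) * (k - 2)) * card E"
proof -
  let ?I = "{u. 2 * u + 3 \<le> n}"
  have finI: "finite ?I" by (rule finite_subset[of _ "{..n}"]) auto
  have finE: "finite E" and finF: "finite F" using finite_family[OF E(1)] finite_family[OF F(1)] by auto
  have "\<exists>u\<in>?I. hits A u" if A: "A \<in> F" for A
  proof -
    obtain j where "j \<le> n" "j + 3 \<le> 2 * count A j" using F(2)[OF A] by auto
    then show ?thesis using hits_exists[of j n A] by blast
  qed
  then have "F = (\<Union>u\<in>?I. {A \<in> F. hits A u})" by auto
  then have "card F \<le> (\<Sum>u\<in>?I. card {A \<in> F. hits A u})"
    using card_UN_le[OF finI, of "\<lambda>u. {A \<in> F. hits A u}"] by simp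
  then have "((n - k) * (n - k - 1) * (n - k - 2)) * card F
    \<le> (\<Sum>u\<in>?I. ((n - k) * (n - k - 1) * (n - k - 2)) * card {A \<in> F. hits A u})"
    unfolding sum_distrib_left[symmetric] by (rule mult_le_mono2)
  also have "\<dots> \<le> (\<Sum>u\<in>?I. (k * (k - 1) * (k - 2)) * card {G \<in> E. cohits G u})"
    using F E assms(1) by (intro sum_mono card_hits_le) auto
  also have "\<dots> = (k * (k - 1) * (k - 2)) * card (\<Union>u\<in>?I. {G \<in> E. cohits G u})"
    unfolding sum_distrib_left[symmetric] using finI finE
    by (subst card_UN_disjoint) (auto dest: cohits_unique)
  also have "\<dots> \<le> (k * (k - 1) * (k - 2)) * card E"
    using finE by (intro mult_le_mono2 card_mono) auto
  finally show ?thesis .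
qed

section \<open>Binomial estimates\<close>

lemma binomial_telescope:
  "j \<le> m \<Longrightarrow> m choose Suc r = (\<Sum>i<j. (m - 1 - i) choose r) + ((m - j) choose Suc r)"
proof (induction j)
  case (Suc j)
  then have e: "m - j = Suc (m - 1 - j)" "m - Suc j = m - 1 - j" by simp_all
  have "(m - j) choose Suc r = ((m - 1 - j) choose r) + ((m - Suc j) choose Suc r)"
    unfolding e by (rule binomial_Suc_Suc)
  moreover have "m choose Suc r = (\<Sum>i<j. (m - 1 - i) choose r) + ((m - j) choose Suc r)"
    using Suc by linarith
  ultimately show ?case unfolding sum.lessThan_Suc by linarith
qed simp

lemma binomial_step: "Suc r * (m choose Suc r) = (m - r) * (m choose r)"
  by (rule trans[OF binomial_absorption binomial_absorb_comp[symmetric]])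

text \<open>Induction on \<open>u\<close>: raising the upper index from \<open>x\<close> to
  \<open>x + 1\<close> multiplies the binomial by \<open>(x + 1) / (x + 1 - q)\<close>, and this
  factor decreases in \<open>x\<close>.\<close>

lemma binomial_log_concave:
  "((w + u + v) choose q) * (w choose q) \<le> ((w + u) choose q) * ((w + v) choose q)"
proof (induction u)
  case (Suc u)
  show ?case
  proof (cases "w < q")
    case False
    define x where "x = w + u"
    have A: "(Suc y - q) * (Suc y choose q) = Suc y * (y choose q)" for y
      using binomial_absorb_comp[of "Suc y" q] by simp
    have pos: "Suc (x + v) - q > 0" "Suc x - q > 0" using False by (auto simp: x_def)
    have ratio: "Suc (x + v) * (Suc x - q) \<le> (Suc (x + v) - q) * Suc x"
    proof -
      define y where "y = Suc x - q"
      have y: "Suc x = q + y" using pos by (simp add: y_def)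
      then have e: "Suc (x + v) = q + y + v" "Suc x - q = y" "Suc (x + v) - q = y + v" by simp_all
      show ?thesis unfolding e unfolding y by (simp add: algebra_simps)
    qed
    have "((Suc x - q) * (Suc (x + v) - q)) * ((Suc (x + v) choose q) * (w choose q))
      = ((Suc (x + v) - q) * (Suc (x + v) choose q)) * ((Suc x - q) * (w choose q))"
      by (simp only: ac_simps)
    also have "\<dots> = (Suc (x + v) * (Suc x - q)) * (((x + v) choose q) * (w choose q))"
      unfolding A by (simp only: ac_simps)
    also have "\<dots> \<le> ((Suc (x + v) - q) * Suc x) * ((x choose q) * ((w + v) choose q))"
      by (rule mult_le_mono[OF ratio Suc.IH[folded x_def]])
    also have "\<dots> = (Suc x * (x choose q)) * ((Suc (x + v) - q) * ((w + v) choose q))"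
      by (simp only: ac_simps)
    also have "\<dots> = ((Suc x - q) * (Suc (x + v) - q)) * ((Suc x choose q) * ((w + v) choose q))"
      unfolding A[symmetric] by (simp only: ac_simps)
    finally show ?thesis using pos by (simp add: x_def)
  qed (simp add: binomial_eq_0)
qed simp

text \<open>To be used with \<open>d = n - 2 * k\<close>. The first three terms of Vandermonde's sum
  for the right-hand binomial are rational multiples of the left-hand one, with common denominator
  \<open>2 * (d + 1) * (d + 2)\<close>.\<close>

lemma choose_lower:
  fixes d k :: nat
  assumes "3 \<le> k"
  shows "((k + d - 2) choose (k - 2)) * (2 * (d + 1) * (d + 2) + 2 * k * (k - 2) * (d + 2)
      + k * (k - 1) * (k - 2) * (k - 3)) \<le> 2 * (d + 1) * (d + 2) * ((2 * k + d - 2) choose (k - 2))"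
proof (cases "k = 3")
  case True
  then show ?thesis by (simp add: algebra_simps)
next
  case False
  define r where "r = k - 4"
  have k: "k = r + 4" using assms False by (simp add: r_def)
  define M where "M = r + d + 2"
  have M: "k + d - 2 = M" "2 * k + d - 2 = k + M" using k by (simp_all add: M_def)
  have "(\<Sum>j\<in>{0,1,2}. (k choose j) * (M choose (r + 2 - j))) \<le> (\<Sum>j\<le>r + 2. (k choose j) * (M choose (r + 2 - j)))"
    by (intro sum_mono2) auto
  then have V: "(M choose (r + 2)) + k * (M choose (r + 1)) + (k choose 2) * (M choose r) \<le> (k + M) choose (r + 2)"
    unfolding vandermonde by (simp add: numeral_2_eq_2)
  have 1: "(r + 2) * (M choose (r + 2)) = (d + 1) * (M choose (r + 1))"
    using binomial_step[of "r + 1" M] by (simp add: M_def)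
  have 2: "(r + 1) * (M choose (r + 1)) = (d + 2) * (M choose r)"
    using binomial_step[of r M] by (simp add: M_def)
  have 3: "2 * (k choose 2) = k * (k - 1)" using k by (simp add: choose_two)
  let ?G = "M choose (r + 2)"
  have e1: "(d + 1) * (k * (M choose (r + 1))) = k * (r + 2) * ?G" 
  proof -
    have "(d + 1) * (k * (M choose (r + 1))) = k * ((d + 1) * (M choose (r + 1)))"
      by (simp only: ac_simps)
    then show ?thesis unfolding 1[symmetric] by (simp only: ac_simps)
  qed
  have e2: "2 * (d + 1) * (d + 2) * ((k choose 2) * (M choose r)) = k * (k - 1) * (r + 2) * (r + 1) * ?G"
  proof -
    have "2 * (d + 1) * (d + 2) * ((k choose 2) * (M choose r))
      = (2 * (k choose 2)) * (d + 1) * ((d + 2) * (M choose r))" by (simp only: ac_simps)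
    also have "\<dots> = k * (k - 1) * (r + 1) * ((d + 1) * (M choose (r + 1)))"
      unfolding 3 2[symmetric] by (simp only: ac_simps)
    also have "\<dots> = k * (k - 1) * (r + 2) * (r + 1) * ?G"
      unfolding 1[symmetric] by (simp only: ac_simps)
    finally show ?thesis .
  qed
  have "?G * (2 * (d + 1) * (d + 2) + 2 * k * (r + 2) * (d + 2) + k * (k - 1) * (r + 2) * (r + 1))
    = 2 * (d + 1) * (d + 2) * ?G + 2 * (d + 2) * ((d + 1) * (k * (M choose (r + 1))))
      + 2 * (d + 1) * (d + 2) * ((k choose 2) * (M choose r))"
    unfolding e1 e2 by (simp add: algebra_simps)
  also have "\<dots> = 2 * (d + 1) * (d + 2) * (?G + k * (M choose (r + 1)) + (k choose 2) * (M choose r))"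
    by (simp only: algebra_simps)
  also have "\<dots> \<le> 2 * (d + 1) * (d + 2) * ((k + M) choose (r + 2))"
    by (rule mult_le_mono2[OF V])
  finally show ?thesis unfolding M using k by (simp add: algebra_simps)
qed

text \<open>Applying Pascal's rule \<open>d\<close> times leaves
  \<open>(k - 1) choose (k - 1) = 1\<close>, and every term split off is at most the first.\<close>

lemma choose_gap:
  fixes d k :: nat
  assumes "2 \<le> k"
  shows "(k + d - 1) choose (k - 1) \<le> d * ((k + d - 2) choose (k - 2)) + 1"
proof -
  define r where "r = k - 2"
  have r: "k = Suc (Suc r)" using assms by (simp add: r_def)
  have "(k + d - 1) choose Suc r = (\<Sum>i<d. (k + d - 1 - 1 - i) choose r) + ((k + d - 1 - d) choose Suc r)"
    by (rule binomial_telescope) (use r in simp)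
  also have "(\<Sum>i<d. (k + d - 1 - 1 - i) choose r) \<le> (\<Sum>i<d. (k + d - 2) choose r)"
    by (intro sum_mono binomial_right_mono) auto
  finally show ?thesis using r by simp
qed

text \<open>The polynomial core of \<open>excess_numeric\<close>, whose second factor on the right
  comes from \<open>choose_lower\<close>. Substituting \<open>k = i + 3\<close> removes the
  truncated subtractions.\<close>

lemma poly_ineq:
  fixes d k :: nat
  assumes "3 \<le> k"
  shows "4 * k * (k - 1) * (k - 2) * (d + 1) * (d + 2) \<le>
    (k + d) * (k + d - 1) * (2 * (d + 1) * (d + 2) + 2 * k * (k - 2) * (d + 2)
      + k * (k - 1) * (k - 2) * (k - 3))"
proof -
  define i where "i = k - 3"
  have k: "k = i + 3" "k - 1 = i + 2" "k - 2 = i + 1" "k - 3 = i" "k + d - 1 = i + d + 2"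
    using assms by (simp_all add: i_def)
  show ?thesis unfolding k(2-5) unfolding k(1) by (simp add: algebra_simps)
qed

text \<open>Absorption splits off a factor \<open>a / b \<le> 3 / 5\<close>, and the hypothesis
  persists when \<open>a\<close> and \<open>b\<close> drop by one; this is done \<open>s\<close>
  times.\<close>

lemma binomial_geometric:
  "5 * a \<le> 3 * b \<Longrightarrow> s \<le> r \<Longrightarrow> 5 ^ s * (a choose r) \<le> 3 ^ s * (b choose r)"
proof (induction s arbitrary: a b r)
  case 0
  then show ?case by (auto intro: binomial_right_mono)
next
  case (Suc s)
  then obtain q where r: "r = Suc q" by (cases r) auto
  have IH: "5 ^ s * ((a - 1) choose q) \<le> 3 ^ s * ((b - 1) choose q)"
    by (rule Suc.IH) (use Suc.prems r in auto)
  have "Suc q * (5 ^ Suc s * (a choose Suc q)) = 5 ^ Suc s * (Suc q * (a choose Suc q))"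
    by (simp only: ac_simps)
  also have "\<dots> = (5 * a) * (5 ^ s * ((a - 1) choose q))"
    unfolding binomial_absorption power_Suc by (simp only: ac_simps)
  also have "\<dots> \<le> (3 * b) * (3 ^ s * ((b - 1) choose q))"
    by (rule mult_le_mono[OF Suc.prems(1) IH])
  also have "\<dots> = 3 ^ Suc s * (Suc q * (b choose Suc q))"
    unfolding binomial_absorption power_Suc by (simp only: ac_simps)
  also have "\<dots> = Suc q * (3 ^ Suc s * (b choose Suc q))"
    by (simp only: ac_simps)
  finally show ?case unfolding r by (simp only: mult_le_cancel1 zero_less_Suc simp_thms)
qed

section \<open>Numerical estimates for fixed \<open>n\<close> and \<open>k\<close>\<close>

locale hm_parameters =
  fixes n k :: nat
  assumes k3: "3 \<le> k" and nk: "2 * k \<le> n"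
begin

text \<open>\<open>N\<close> and \<open>C\<close> count the \<open>k\<close>-sets through one and
  through two given points; \<open>g\<close> counts those through one point that are disjoint from a
  given \<open>k\<close>-set not containing it.\<close>

abbreviation "N \<equiv> (n - 1) choose (k - 1)"
abbreviation "C \<equiv> (n - 2) choose (k - 2)"
abbreviation "g \<equiv> (n - k - 1) choose (k - 1)"

lemma h_eq: "h n k = int N - int g + 1"
  by (simp add: h_def)

lemma g_pos: "1 \<le> g"
  using nk k3 by (simp add: Suc_leI)

lemma N_C: "(k - 1) * N = (n - 1) * C"
proof -
  define r s where "r = k - 2" and "s = n - 2"
  have "k - 1 = Suc r" "n - 1 = Suc s" "k - 2 = r" "n - 2 = s"
    using k3 nk by (simp_all add: r_def s_def)
  then show ?thesis using Suc_times_binomial[of r s] by simp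
qed

lemma choose_k: "k * ((n - 1) choose k) = (n - k) * N"
proof -
  obtain r where r: "k = Suc r" using k3 by (cases k) auto
  show ?thesis using binomial_step[of r "n - 1"] unfolding r by simp
qed

text \<open>Integer versions for the polynomial estimates: \<open>D\<close> is the \<open>d\<close>
  of \<open>choose_lower\<close>, \<open>W\<close> its polynomial factor, and \<open>G\<close> the
  largest term split off in \<open>choose_gap\<close>.\<close>

abbreviation "K \<equiv> int k"
abbreviation "D \<equiv> int n - 2 * int k"
abbreviation "G \<equiv> int ((n - k - 2) choose (k - 2))"
abbreviation "W \<equiv> 2 * (D + 1) * (D + 2) + 2 * K * (K - 2) * (D + 2) + K * (K - 1) * (K - 2) * (K - 3)"

lemma K_D: "3 \<le> K" "0 \<le> D"
  using k3 nk by simp_all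

lemma int_conv:
  "int (k - 1) = K - 1" "int (k - 2) = K - 2" "int (k - 3) = K - 3" "int (n - 2 * k) = D"
  "int (n - k) = K + D" "int (n - k - 1) = K + D - 1" "int (n - k - 2) = K + D - 2"
  "int (n - 1) = 2 * K + D - 1" "int (k + (n - 2 * k)) = K + D" "int (k + (n - 2 * k) - 1) = K + D - 1"
  using k3 nk by (auto simp: of_nat_diff)

lemma gap_bound: "G * W \<le> 2 * (D + 1) * (D + 2) * int C"
proof -
  have e: "k + (n - 2 * k) - 2 = n - k - 2" "2 * k + (n - 2 * k) - 2 = n - 2" using nk by simp_all
  have "int (((k + (n - 2 * k) - 2) choose (k - 2)) * (2 * (n - 2 * k + 1) * (n - 2 * k + 2)
      + 2 * k * (k - 2) * (n - 2 * k + 2) + k * (k - 1) * (k - 2) * (k - 3)))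
    \<le> int (2 * (n - 2 * k + 1) * (n - 2 * k + 2) * ((2 * k + (n - 2 * k) - 2) choose (k - 2)))"
    using choose_lower[OF k3, of "n - 2 * k"] by (simp only: of_nat_le_iff)
  then show ?thesis
    unfolding e unfolding of_nat_mult of_nat_add of_nat_1 of_nat_numeral int_conv .
qed

lemma g_bound: "int g - 1 \<le> D * G"
proof -
  have e: "k + (n - 2 * k) - 2 = n - k - 2" "k + (n - 2 * k) - 1 = n - k - 1" using nk by simp_all
  have "int ((k + (n - 2 * k) - 1) choose (k - 1)) \<le> int ((n - 2 * k) * ((k + (n - 2 * k) - 2) choose (k - 2)) + 1)"
    using choose_gap[of k "n - 2 * k"] k3 by (simp only: of_nat_le_iff)
  then show ?thesis
    unfolding e unfolding of_nat_mult of_nat_add of_nat_1 int_conv by simp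
qed

lemma poly_bound: "4 * K * (K - 1) * (K - 2) * (D + 1) * (D + 2) \<le> (K + D) * (K + D - 1) * W"
proof -
  have "int (4 * k * (k - 1) * (k - 2) * (n - 2 * k + 1) * (n - 2 * k + 2)) \<le>
    int ((k + (n - 2 * k)) * (k + (n - 2 * k) - 1) * (2 * (n - 2 * k + 1) * (n - 2 * k + 2)
      + 2 * k * (k - 2) * (n - 2 * k + 2) + k * (k - 1) * (k - 2) * (k - 3)))"
    using poly_ineq[OF k3, of "n - 2 * k"] by (simp only: of_nat_le_iff)
  then show ?thesis
    unfolding of_nat_mult int_conv unfolding of_nat_add of_nat_mult of_nat_1 of_nat_numeral int_conv .
qed

lemma N_C_int: "(K - 1) * int N = (2 * K + D - 1) * int C"
  using N_C[THEN arg_cong[of _ _ int]] unfolding of_nat_mult int_conv .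

text \<open>The numerical content of \<open>excess_sum_bound\<close>: a relative surplus of
  \<open>U / L - 1\<close>, taken over \<open>C\<close> sets, covers the required amount.\<close>

lemma excess_numeric:
  "int (k * (k - 1) * (k - 2)) * (int ((n - 1) choose k) - int N + 2 * (int g - 1))
    \<le> (int ((n - k) * (n - k - 1) * (n - k - 2)) - int (k * (k - 1) * (k - 2))) * int C"
proof -
  define L U where "L = int (k * (k - 1) * (k - 2))" and "U = int ((n - k) * (n - k - 1) * (n - k - 2))"
  have L: "L = K * (K - 1) * (K - 2)" and U: "U = (K + D) * (K + D - 1) * (K + D - 2)"
    unfolding L_def U_def of_nat_mult int_conv by simp_all
  have ck: "K * int ((n - 1) choose k) = (K + D) * int N"
    using choose_k[THEN arg_cong[of _ _ int]] unfolding of_nat_mult int_conv .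
  \<comment> \<open>The first summand pays exactly for the term with \<open>N\<close>, the second one for the term with \<open>g\<close>.\<close>
  have UL: "U - L = (K - 2) * D * (2 * K + D - 1) + D * (K + D) * (K + D - 1)"
    unfolding U L by (simp add: algebra_simps)
  have 1: "L * (int ((n - 1) choose k) - int N) = (K - 2) * D * (2 * K + D - 1) * int C"
  proof -
    have "L * (int ((n - 1) choose k) - int N)
      = (K - 1) * (K - 2) * (K * int ((n - 1) choose k) - K * int N)"
      unfolding L by (simp add: algebra_simps)
    also have "\<dots> = (K - 2) * D * ((K - 1) * int N)"
      unfolding ck by (simp add: algebra_simps)
    finally show ?thesis unfolding N_C_int by (simp only: ac_simps)
  qed
  have 2: "L * (2 * (int g - 1)) \<le> D * (K + D) * (K + D - 1) * int C"
  proof -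
    \<comment> \<open>Scaling by the denominator from \<open>choose_lower\<close> lets
      \<open>W\<close> be eliminated between \<open>poly_bound\<close> and
      \<open>gap_bound\<close>.\<close>
    have pos: "0 < 2 * (D + 1) * (D + 2)" using K_D by simp
    have "2 * (D + 1) * (D + 2) * (L * (2 * (int g - 1)))
      = (4 * K * (K - 1) * (K - 2) * (D + 1) * (D + 2)) * (int g - 1)"
      unfolding L by (simp add: algebra_simps)
    also have "\<dots> \<le> (4 * K * (K - 1) * (K - 2) * (D + 1) * (D + 2)) * (D * G)"
      using g_bound K_D by (intro mult_left_mono) auto
    also have "\<dots> \<le> ((K + D) * (K + D - 1) * W) * (D * G)"
      using poly_bound K_D by (intro mult_right_mono) auto
    also have "\<dots> = (D * (K + D) * (K + D - 1)) * (G * W)" by (simp only: ac_simps)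
    also have "\<dots> \<le> (D * (K + D) * (K + D - 1)) * (2 * (D + 1) * (D + 2) * int C)"
      using gap_bound K_D by (intro mult_left_mono) auto
    also have "\<dots> = 2 * (D + 1) * (D + 2) * (D * (K + D) * (K + D - 1) * int C)"
      by (simp only: ac_simps)
    finally show ?thesis using pos by (simp only: mult_le_cancel_left_pos)
  qed
  have "L * (int ((n - 1) choose k) - int N + 2 * (int g - 1))
    = L * (int ((n - 1) choose k) - int N) + L * (2 * (int g - 1))" by (rule distrib_left)
  also have "\<dots> \<le> (U - L) * int C" unfolding UL distrib_right 1 using 2 by simp
  finally show ?thesis unfolding L_def U_def .
qed

text \<open>Both sides count the \<open>k\<close>-sets through a fixed point that meet a given
  \<open>k\<close>-set avoiding it; the sum sorts them by their first point there.\<close>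

lemma h_sum: "h n k - 1 = (\<Sum>i<k. int ((n - 2 - i) choose (k - 2)))"
proof -
  define r where "r = k - 2"
  have r: "k - 1 = Suc r" using k3 by (simp add: r_def)
  have "N = (\<Sum>i<k. (n - 1 - 1 - i) choose r) + ((n - 1 - k) choose Suc r)"
    unfolding r by (rule binomial_telescope) (use nk k3 in simp)
  moreover have "n - 1 - 1 = n - 2" "n - 1 - k = n - k - 1" by simp_all
  ultimately have "N = (\<Sum>i<k. (n - 2 - i) choose r) + g" unfolding r by simp
  then have "int N = (\<Sum>i<k. int ((n - 2 - i) choose r)) + int g"
    by (metis of_nat_add of_nat_sum)
  then show ?thesis unfolding h_eq r_def by simp
qed

text \<open>The constants are chosen for \<open>unbalanced_product\<close>: \<open>(3 + 6/13)\<^sup>2 < 12\<close> settles its first case,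
  and any constant up to \<open>7/6\<close> in place of \<open>12/11\<close> would do in the second.\<close>

lemma h_dichotomy: "13 * int C \<le> 6 * h n k \<or> 11 * int N \<le> 12 * h n k"
proof (cases "k = 3")
  case True
  have "{..<3::nat} = {0,1,2}" by auto
  then have "h n k - 1 = int (n - 2) + int (n - 3) + int (n - 4)"
    using h_sum True by (simp add: numeral_eq_Suc)
  then show ?thesis using nk True by (simp add: of_nat_diff)
next
  case False
  then have k4: "4 \<le> k" using k3 by simp
  show ?thesis
  proof (cases "3 * (n - 1) \<le> 5 * (n - k - 1)")
    case True
    \<comment> \<open>Consecutive terms have ratio at least \<open>3/5\<close>, and
      \<open>1 + 3/5 + 9/25 + 27/125 = 272/125\<close> exceeds \<open>13/6\<close>. Four terms exist
      because \<open>k \<ge> 4\<close>.\<close>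
    define T where "T i = int ((n - 2 - i) choose (k - 2))" for i
    have step: "3 * T i \<le> 5 * T (Suc i)" if "i < 3" for i
    proof -
      have "(n - 2 - i) * ((n - 2 - Suc i) choose (k - 2)) = (n - k - i) * ((n - 2 - i) choose (k - 2))"
      proof -
        have e: "n - 2 - i - (k - 2) = n - k - i" "n - 2 - i - 1 = n - 2 - Suc i" using k3 by simp_all
        show ?thesis using binomial_absorb_comp[of "n - 2 - i" "k - 2"] unfolding e by simp
      qed
      then have eq: "int (n - 2 - i) * T (Suc i) = int (n - k - i) * T i"
        unfolding T_def by (metis of_nat_mult)
      have "3 * (n - 2 - i) \<le> 5 * (n - k - i)" using True that nk k4 by simp
      then have le: "3 * int (n - 2 - i) \<le> 5 * int (n - k - i)" by linarith
      have "int (n - 2 - i) * (3 * T i) = (3 * int (n - 2 - i)) * T i" by simp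
      also have "\<dots> \<le> (5 * int (n - k - i)) * T i"
        using le by (intro mult_right_mono) (auto simp: T_def)
      also have "\<dots> = int (n - 2 - i) * (5 * T (Suc i))" using eq by simp
      finally have "int (n - 2 - i) * (3 * T i) \<le> int (n - 2 - i) * (5 * T (Suc i))" .
      moreover have "0 < int (n - 2 - i)" using nk k4 that by simp
      ultimately show ?thesis by (simp only: mult_le_cancel_left_pos)
    qed
    have "(\<Sum>i\<in>{0,1,2,3}. T i) \<le> (\<Sum>i<k. T i)"
      using k4 by (intro sum_mono2) (auto simp: T_def)
    moreover have "(\<Sum>i\<in>{0,1,2,3}. T i) = T 0 + T 1 + T 2 + T 3" by simp
    moreover have "(\<Sum>i<k. T i) = h n k - 1" unfolding h_sum T_def ..
    moreover have "int C = T 0" by (simp add: T_def)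
    moreover have "3 * T 0 \<le> 5 * T 1" using step[of 0] by simp
    moreover have "3 * T 1 \<le> 5 * T 2" using step[of 1] by (simp add: numeral_2_eq_2)
    moreover have "3 * T 2 \<le> 5 * T 3"
      using step[of 2] by (simp add: numeral_3_eq_3 numeral_2_eq_2)
    moreover have "0 \<le> T 0" by (simp add: T_def)
    ultimately show ?thesis by linarith
  next
    case F: False
    \<comment> \<open>Here \<open>g / N\<close> is at most the power of \<open>3/5\<close> with
      exponent \<open>k - 1\<close>, which is below \<open>1/12\<close> from \<open>k = 6\<close>
      on; for \<open>k = 4\<close> and \<open>k = 5\<close> only a few \<open>n\<close> are left to
      compute.\<close>
    consider "k = 4" | "k = 5" | "6 \<le> k" using k4 by linarith
    then show ?thesis
    proof cases
      case 1
      then have "n \<in> {8,9,10}" using F nk by auto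
      moreover have "(7::nat) choose 3 = 35" "(3::nat) choose 3 = 1" "(8::nat) choose 3 = 56"
        "(4::nat) choose 3 = 4" "(8::nat) choose 2 = 28" "(9::nat) choose 3 = 84" "(5::nat) choose 3 = 10"
        by (simp_all add: eval_nat_numeral)
      ultimately show ?thesis using 1 by (auto simp: h_def)
    next
      case 2
      then have "n \<in> {10,11,12,13}" using F nk by auto
      moreover have "(9::nat) choose 4 = 126" "(4::nat) choose 4 = 1" "(10::nat) choose 4 = 210"
        "(5::nat) choose 4 = 5" "(11::nat) choose 4 = 330" "(6::nat) choose 4 = 15"
        "(12::nat) choose 4 = 495" "(7::nat) choose 4 = 35"
        by (simp_all add: eval_nat_numeral)
      ultimately show ?thesis using 2 by (auto simp: h_def)
    next
      case 3
      have "5 * (n - k - 1) \<le> 3 * (n - 1)" "5 \<le> k - 1" using 3 F by linarith+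
      from binomial_geometric[OF this] have "3125 * g \<le> 243 * N" by simp
      then have "3125 * int g \<le> 243 * int N" by linarith
      then have "12 * int g \<le> int N" by linarith
      then have "11 * int N \<le> 12 * (int N - int g + 1)" by simp
      then show ?thesis unfolding h_eq ..
    qed
  qed
qed

text \<open>As \<open>(K - 1) * (N - 2 * C) = (D + 1) * C\<close>, for \<open>n < 3 * k\<close> the
  bounds on \<open>g - 1\<close> suffice, using \<open>D \<le> K - 1\<close>. Otherwise
  \<open>3 * C \<le> N\<close>, and either alternative of \<open>h_dichotomy\<close> gives the
  claim.\<close>

lemma two_C_le: "2 * int C \<le> h n k"
proof (cases "n < 3 * k")
  case True
  have W: "2 * (D + 2) * ((K - 1) * D) \<le> W"
  proof -
    have "(K - 1) * D \<le> (K - 1) * (K - 1)" using True K_D by (intro mult_left_mono) auto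
    also have "\<dots> \<le> D + 1 + K * (K - 2)" using K_D by (simp add: algebra_simps)
    finally have "2 * (D + 2) * ((K - 1) * D) \<le> 2 * (D + 2) * (D + 1 + K * (K - 2))"
      using K_D by (intro mult_left_mono) auto
    also have "\<dots> = 2 * (D + 1) * (D + 2) + 2 * K * (K - 2) * (D + 2)" by (simp add: algebra_simps)
    also have "\<dots> \<le> W" using K_D by simp
    finally show ?thesis .
  qed
  have "2 * (D + 2) * ((K - 1) * (D * G)) = G * (2 * (D + 2) * ((K - 1) * D))" by (simp only: ac_simps)
  also have "\<dots> \<le> G * W" using W by (intro mult_left_mono) auto
  also have "\<dots> \<le> 2 * (D + 2) * ((D + 1) * int C)" using gap_bound by (simp only: ac_simps)
  finally have le: "2 * (D + 2) * ((K - 1) * (D * G)) \<le> 2 * (D + 2) * ((D + 1) * int C)" .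
  have "0 < 2 * (D + 2)" using K_D by simp
  with le have "(K - 1) * (D * G) \<le> (D + 1) * int C" by (rule mult_left_le_imp_le)
  moreover have "(K - 1) * (int g - 1) \<le> (K - 1) * (D * G)"
    using g_bound K_D by (intro mult_left_mono) auto
  moreover have "(D + 1) * int C = (K - 1) * (int N - 2 * int C)"
    using N_C_int by (simp add: algebra_simps)
  ultimately have "(K - 1) * (int g - 1) \<le> (K - 1) * (int N - 2 * int C)" by linarith
  then have "int g - 1 \<le> int N - 2 * int C" using K_D by simp
  then show ?thesis unfolding h_eq by simp
next
  case False
  have "(3 * (K - 1)) * int C \<le> (2 * K + D - 1) * int C"
    using False by (intro mult_right_mono) auto
  then have "(K - 1) * (3 * int C) \<le> (2 * K + D - 1) * int C" by (simp only: ac_simps)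
  then have "(K - 1) * (3 * int C) \<le> (K - 1) * int N" unfolding N_C_int .
  then have "3 * int C \<le> int N" using K_D by simp
  then show ?thesis using h_dichotomy by linarith
qed

end

section \<open>Sets meeting every member of a non-trivial family\<close>

lemma card_meeting_sum:
  assumes "finite V" "S \<subseteq> V" "card S \<le> t" "t \<le> card V" "Y \<subseteq> nsets V (Suc r)"
    and "\<And>T. T \<in> Y \<Longrightarrow> T \<inter> S \<noteq> {}"
  shows "card Y \<le> (\<Sum>j<t. (card V - 1 - j) choose r)"
proof -
  have "card Y + ((card V - card S) choose Suc r) \<le> card V choose Suc r"
    by (rule card_meeting_le[OF assms(1,2,5,6)])
  moreover have "(card V - t) choose Suc r \<le> (card V - card S) choose Suc r"
    by (rule binomial_right_mono) (use assms in simp)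
  ultimately show ?thesis using binomial_telescope[OF assms(4), of r] by linarith
qed

text \<open>Sort the sets by their first point \<open>s\<close> in \<open>S\<close>; having
  \<open>s\<close>, each must still meet \<open>A s\<close>, which avoids \<open>s\<close>, and is
  sorted by its first point there. The indices \<open>i\<close> and \<open>j\<close> number these
  two first hits.\<close>

lemma card_double_meeting:
  fixes S V :: "nat set"
  assumes "finite S" "finite V" "S \<subseteq> V" "card S + t \<le> card V" "Y \<subseteq> nsets V (Suc (Suc r))"
    and "\<And>B. B \<in> Y \<Longrightarrow> B \<inter> S \<noteq> {}"
    and "\<And>s. s \<in> S \<Longrightarrow> s \<notin> A s \<and> finite (A s) \<and> card (A s) \<le> t"
    and "\<And>s B. s \<in> S \<Longrightarrow> B \<in> Y \<Longrightarrow> B \<inter> A s \<noteq> {}"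
  shows "card Y \<le> (\<Sum>i<card S. \<Sum>j<t. (card V - 2 - i - j) choose r)"
  using assms
proof (induction S arbitrary: V Y rule: finite_induct)
  case empty
  then have "Y = {}" by auto
  then show ?case by simp
next
  case (insert s S)
  let ?V = "V - {s}"
  have sV: "s \<in> V" and cV: "card ?V = card V - 1" using insert.prems by auto
  have finY: "finite Y" using finite_family insert.prems by blast
  have "card (link s Y) \<le> (\<Sum>j<t. (card ?V - 1 - j) choose r)"
  \<comment> \<open>Earlier points of \<open>S\<close> are already gone from the ground set, so
    \<open>A s\<close> is cut down to what is left.\<close>
  proof (rule card_meeting_sum[where S = "A s \<inter> ?V"])
    show "card (A s \<inter> ?V) \<le> t"
      using insert.prems(6)[of s] card_mono[of "A s" "A s \<inter> ?V"] by auto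
    show "t \<le> card ?V" using insert.prems(3) insert.hyps cV by simp
    show "link s Y \<subseteq> nsets ?V (Suc r)" using link_nsets[OF insert.prems(4), of s] by simp
    fix T assume T: "T \<in> link s Y"
    then have "insert s T \<in> Y" by (simp add: mem_link)
    then have "insert s T \<inter> A s \<noteq> {}" "insert s T \<subseteq> V"
      using insert.prems(7)[of s] nsetsD[OF insert.prems(4)] by auto
    moreover have "s \<notin> A s" "s \<notin> T" using insert.prems(6) T by (auto simp: mem_link)
    ultimately show "T \<inter> (A s \<inter> ?V) \<noteq> {}" by auto
  qed (use insert.prems in auto)
  then have 1: "card (link s Y) \<le> (\<Sum>j<t. (card V - 2 - 0 - j) choose r)"
    unfolding cV by (simp add: numeral_2_eq_2)
  have "card (deletion s Y) \<le> (\<Sum>i<card S. \<Sum>j<t. (card ?V - 2 - i - j) choose r)"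
  proof (rule insert.IH)
    show "S \<subseteq> ?V" using insert.prems insert.hyps by auto
    show "card S + t \<le> card ?V" using insert.prems(3) insert.hyps cV by simp
    show "deletion s Y \<subseteq> nsets ?V (Suc (Suc r))" by (rule deletion_nsets[OF insert.prems(4)])
    show "B \<inter> S \<noteq> {}" if "B \<in> deletion s Y" for B
      using insert.prems(5)[of B] that by (auto simp: deletion_def)
    show "x \<notin> A x \<and> finite (A x) \<and> card (A x) \<le> t" if "x \<in> S" for x
      using insert.prems(6) that by blast
    show "B \<inter> A x \<noteq> {}" if "x \<in> S" "B \<in> deletion s Y" for x B
      using insert.prems(7) that by (auto simp: deletion_def)
  qed (use insert.prems in simp)
  then have 2: "card (deletion s Y) \<le> (\<Sum>i<card S. \<Sum>j<t. (card V - 2 - Suc i - j) choose r)"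
    unfolding cV by (simp add: diff_commute)
  have "card Y = card (link s Y) + card (deletion s Y)" by (rule card_link_deletion[OF finY])
  also have "\<dots> \<le> (\<Sum>i<Suc (card S). \<Sum>j<t. (card V - 2 - i - j) choose r)"
    unfolding sum.lessThan_Suc_shift using 1 2 by simp
  finally show ?case using insert.hyps by simp
qed

context hm_parameters
begin

text \<open>As \<open>A\<close> is not a star, every point \<open>s\<close> is avoided by some
  member \<open>f s\<close>, and \<open>B\<close> meets all of these. Multiplied by
  \<open>C\<close>, the double first-hit sum factors by log-concavity into the square of
  \<open>h n k - 1\<close>.\<close>

lemma nontrivial_small_product:
  assumes A: "A \<subseteq> nsets {1..n} k" and B: "B \<subseteq> nsets {1..n} k"
    and cr: "cross_intersecting A B" and ns: "\<not> star A" and small: "card A \<le> C"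
  shows "int (card A) * int (card B) \<le> (h n k)\<^sup>2"
proof -
  have "\<exists>T\<in>A. s \<notin> T" for s using ns by (auto simp: star_def)
  then obtain f where f: "\<And>s. f s \<in> A" "\<And>s. s \<notin> f s" by metis
  define r where "r = k - 2"
  have k: "k = Suc (Suc r)" using k3 by (simp add: r_def)
  define T where "T i = (n - 2 - i) choose r" for i
  \<comment> \<open>Any member of \<open>A\<close> would serve; the index \<open>0\<close> is
    arbitrary.\<close>
  let ?S = "f 0"
  have S: "?S \<subseteq> {1..n}" "finite ?S" "card ?S = k" using nsetsD[OF A f(1)[of 0]] by auto
  have "card B \<le> (\<Sum>i<card ?S. \<Sum>j<k. (card {1..n} - 2 - i - j) choose r)"
  proof (rule card_double_meeting[where A = f])
    show "card ?S + k \<le> card {1..n}" using S nk by simp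
    show "B \<subseteq> nsets {1..n} (Suc (Suc r))" using B k by simp
    show "X \<inter> f 0 \<noteq> {}" if "X \<in> B" for X
      using cr f that by (metis Int_commute cross_intersecting_def)
    show "X \<inter> f s \<noteq> {}" if "X \<in> B" for X s
      using cr f that by (metis Int_commute cross_intersecting_def)
    show "s \<notin> f s \<and> finite (f s) \<and> card (f s) \<le> k" for s
      using nsetsD[OF A f(1)[of s]] f(2)[of s] by auto
  qed (use S in auto)
  then have B': "card B \<le> (\<Sum>i<k. \<Sum>j<k. (n - 2 - i - j) choose r)" using S by simp
  have conc: "C * ((n - 2 - i - j) choose r) \<le> T i * T j" if "i < k" "j < k" for i j
  proof -
    have e: "n - 2 - i - j + j = n - 2 - i" "n - 2 - i + i = n - 2"
      "n - 2 - i - j + i = n - 2 - j" using that nk by simp_all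
    show ?thesis using binomial_log_concave[of "n - 2 - i - j" j i r] unfolding e T_def r_def .
  qed
  have "C * card B \<le> (\<Sum>i<k. \<Sum>j<k. C * ((n - 2 - i - j) choose r))"
    using mult_le_mono2[OF B', of C] by (simp only: sum_distrib_left)
  also have "\<dots> \<le> (\<Sum>i<k. \<Sum>j<k. T i * T j)" using conc by (intro sum_mono) auto
  also have "\<dots> = (\<Sum>i<k. T i)\<^sup>2" by (simp only: sum_product power2_eq_square)
  finally have "C * card B \<le> (\<Sum>i<k. T i)\<^sup>2" .
  then have "int (C * card B) \<le> int ((\<Sum>i<k. T i)\<^sup>2)" by (simp only: of_nat_le_iff)
  also have "\<dots> = (h n k - 1)\<^sup>2" unfolding h_sum T_def r_def by simp
  also have "\<dots> \<le> (h n k)\<^sup>2" using two_C_le h_sum by (intro power_mono) (auto intro: sum_nonneg)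
  finally have "int C * int (card B) \<le> (h n k)\<^sup>2" by simp
  moreover have "int (card A) * int (card B) \<le> int C * int (card B)"
    using small by (intro mult_right_mono) auto
  ultimately show ?thesis by linarith
qed

section \<open>The sum bound for uniformities \<open>k - 1\<close> and \<open>k\<close>\<close>

text \<open>\<open>E\<close> contains all \<open>k\<close>-sets missed by some member of
  \<open>F\<close>, and it exceeds \<open>F\<close> by the factor \<open>U / L\<close>. A family
  cross-intersecting \<open>F\<close> avoids the missed sets, so this becomes a sum bound.\<close>

lemma excess_sum_bound:
  assumes F: "F \<subseteq> nsets {1..n} k" "\<And>A. A \<in> F \<Longrightarrow> \<exists>j\<in>{1..n}. j + 3 \<le> 2 * count A j"
    and E: "E \<subseteq> nsets {1..n} k" "\<And>H A. H \<in> nsets {1..n} k \<Longrightarrow> A \<in> F \<Longrightarrow> A \<inter> H = {} \<Longrightarrow> H \<in> E"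
    and big: "C \<le> card F"
  shows "int (card F) - int (card E) + int ((n - 1) choose k) \<le> int N - 2 * (int g - 1)"
proof -
  define L U where "L = int (k * (k - 1) * (k - 2))" and "U = int ((n - k) * (n - k - 1) * (n - k - 2))"
  have "int (((n - k) * (n - k - 1) * (n - k - 2)) * card F) \<le> int ((k * (k - 1) * (k - 2)) * card E)"
    using excess_family_bound[OF nk F E] by (simp only: of_nat_le_iff)
  then have UF: "U * int (card F) \<le> L * int (card E)" by (simp add: L_def U_def)
  have "k * (k - 1) * (k - 2) \<le> (n - k) * (n - k - 1) * (n - k - 2)"
    using nk by (intro mult_le_mono) auto
  then have "(U - L) * int C \<le> (U - L) * int (card F)"
    using big unfolding L_def U_def by (intro mult_left_mono) (auto simp flip: of_nat_mult)
  moreover have "L * (int ((n - 1) choose k) - int N + 2 * (int g - 1)) \<le> (U - L) * int C"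
    using excess_numeric by (simp only: L_def U_def)
  ultimately have "L * (int (card F) - int (card E) + int ((n - 1) choose k)) \<le> L * (int N - 2 * (int g - 1))"
    using UF by (simp add: algebra_simps)
  moreover have "0 < L" using k3 by (simp add: L_def)
  ultimately show ?thesis by (simp only: mult_le_cancel_left_pos)
qed

lemma N_split: "N = C + ((n - 2) choose (k - 1))"
proof -
  have "n - 1 = Suc (n - 2)" "k - 1 = Suc (k - 2)" using k3 nk by simp_all
  then show ?thesis by simp
qed

text \<open>Split at \<open>2\<close>: reflection bounds the link of \<open>X\<close> with the
  deletion of \<open>Y\<close>, and \<open>cross_sum_bound\<close> the other two parts. If a member
  of \<open>Y\<close> avoiding \<open>2\<close> has no balanced prefix, every member of
  \<open>F\<close> has large excess instead.\<close>

lemma sum_bound_compressed: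
  assumes X: "X \<subseteq> nsets {2..n} (k - 1)" and Y: "Y \<subseteq> nsets {2..n} k"
    and cr: "cross_intersecting X Y" and cX: "compressed {2..n} X" and cY: "compressed {2..n} Y"
    and big: "C < card X" and ne: "Y \<noteq> {}"
  shows "int (card X) + int (card Y) \<le> h n k"
proof -
  \<comment> \<open>Adding \<open>1\<close> makes \<open>X\<close> uniform of rank \<open>k\<close>, so that the reflection and excess bounds apply.\<close>
  define F where "F = insert 1 ` X"
  have not1: "1 \<notin> S" if "S \<in> X" for S using nsetsD[OF X that] by auto
  have inj: "inj_on (insert 1) X" using not1 by (auto simp: inj_on_def insert_ident)
  have cF: "card F = card X" unfolding F_def by (rule card_image[OF inj])
  have sub: "{2..n} \<subseteq> {1..n}" by auto
  have F: "F \<subseteq> nsets {1..n} k"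
  proof
    fix A assume "A \<in> F"
    then obtain S where S: "A = insert 1 S" "S \<in> X" by (auto simp: F_def)
    have "S \<subseteq> {2..n}" "finite S" "card S = k - 1" using nsetsD[OF X S(2)] by auto
    then show "A \<in> nsets {1..n} k" using S not1 k3 nk by (auto simp: nsets_iff)
  qed
  have Y1: "Y \<subseteq> nsets {1..n} k" using nsets_mono[OF sub] Y by blast
  have crF: "cross_intersecting F Y" using cr by (auto simp: F_def cross_intersecting_def)
  have compF: "compressed {2..n} F"
    unfolding compressed_def
  proof (intro ballI impI)
    fix A i j assume *: "A \<in> F" "i \<in> {2..n}" "j \<in> {2..n}" "i < j" "j \<in> A" "i \<notin> A"
    then obtain S where S: "A = insert 1 S" "S \<in> X" by (auto simp: F_def)
    have "repl i j S \<in> X" using compressedD[OF cX S(2)] * S by auto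
    moreover have "repl i j A = insert 1 (repl i j S)" using * S by (auto simp: repl_def)
    ultimately show "repl i j A \<in> F" by (simp add: F_def)
  qed
  show ?thesis
  proof (cases "\<forall>B\<in>Y. 2 \<notin> B \<longrightarrow> (\<exists>j\<in>{1..n}. j \<le> 2 * count B j)")
    case True
    have "compressed {3..n} F" using compF by (rule compressed_mono) auto
    then have "card {A \<in> F. 1 \<in> A \<and> 2 \<in> A} + card {B \<in> Y. 1 \<notin> B \<and> 2 \<notin> B} \<le> C"
      using reflection_bound[OF nk _ F Y1 crF] True k3 by auto
    moreover have "1 \<notin> B" if "B \<in> Y" for B using nsetsD[OF Y that] by auto
    then have "{B \<in> Y. 1 \<notin> B \<and> 2 \<notin> B} = deletion 2 Y" by (auto simp: deletion_def)
    moreover have "card {A \<in> F. 1 \<in> A \<and> 2 \<in> A} = card (link 2 X)"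
    proof -
      have "{A \<in> F. 1 \<in> A \<and> 2 \<in> A} = insert 1 ` {S \<in> X. 2 \<in> S}" by (auto simp: F_def)
      then show ?thesis
        using card_image[OF inj_on_subset[OF inj, of "{S \<in> X. 2 \<in> S}"]] by (simp add: card_link_eq)
    qed
    ultimately have 1: "card (link 2 X) + card (deletion 2 Y) \<le> C" by simp
    let ?V = "{2..n} - {2}"
    have V: "finite ?V" "card ?V = n - 2" using nk k3 by auto
    have finX: "finite X" and finY: "finite Y" using finite_family[OF X] finite_family[OF Y] by auto
    \<comment> \<open>Otherwise \<open>X\<close> would be as small as its link, which has at most
      \<open>C\<close> members.\<close>
    have "deletion 2 X \<noteq> {}"
    proof
      assume "deletion 2 X = {}"
      then have "card X = card (link 2 X)" using card_link_deletion[OF finX, of 2] by simp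
      then show False using 1 big by simp
    qed
    moreover have "link 2 Y \<noteq> {}"
    proof -
      obtain B where B: "B \<in> Y" using ne by blast
      then have B': "B \<subseteq> {2..n}" "card B = k" using nsetsD[OF Y] by auto
      have "\<exists>B'\<in>Y. 2 \<in> B'"
      proof (cases "2 \<in> B")
        case False
        obtain j where j: "j \<in> B" using B' k3 by (metis card.empty ex_in_conv not_numeral_le_zero)
        then have "2 < j" using B' False by (metis atLeastAtMost_iff le_neq_implies_less subsetD)
        then have "repl 2 j B \<in> Y" using compressedD[OF cY B, of 2 j] B' j False by auto
        then show ?thesis by (auto simp: repl_def)
      qed (use B in blast)
      then show ?thesis by (auto simp: link_def)
    qed
    moreover have "cross_intersecting (deletion 2 X) (link 2 Y)"
      unfolding cross_intersecting_def
    proof (intro ballI)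
      fix S T assume "S \<in> deletion 2 X" "T \<in> link 2 Y"
      then have "S \<in> X" "2 \<notin> S" "insert 2 T \<in> Y" by (auto simp: deletion_def mem_link)
      then have "S \<inter> insert 2 T \<noteq> {}" using cr unfolding cross_intersecting_def by blast
      then show "S \<inter> T \<noteq> {}" using \<open>2 \<notin> S\<close> by blast
    qed
    ultimately have "card (deletion 2 X) + card (link 2 Y) + ((card ?V - (k - 1)) choose (k - 1))
        \<le> (card ?V choose (k - 1)) + 1"
      using cross_sum_bound[OF V(1), of "k - 1" "deletion 2 X" "link 2 Y"]
        V nk k3 deletion_nsets[OF X] link_nsets[OF Y] by auto
    moreover have "card ?V - (k - 1) = n - k - 1" using V nk k3 by simp
    ultimately have "card (deletion 2 X) + card (link 2 Y) + g \<le> ((n - 2) choose (k - 1)) + 1"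
      using V by simp
    then have "card X + card Y + g \<le> N + 1"
      using 1 N_split card_link_deletion[OF finX, of 2] card_link_deletion[OF finY, of 2] by linarith
    then show ?thesis unfolding h_eq by linarith
  next
    case False
    then obtain B0 where B0: "B0 \<in> Y" "2 \<notin> B0" "\<And>j. j \<in> {1..n} \<Longrightarrow> 2 * count B0 j < j"
      by (auto simp: not_le)
    have hit: "\<exists>j\<in>{1..n}. j + 3 \<le> 2 * count A j" if A: "A \<in> F" for A
    proof (rule compressed_hits[OF compF _ A, where B = B0])
      show "{1..<2} \<subseteq> A" using A by (auto simp: F_def)
      show "A' \<inter> B0 \<noteq> {}" if "A' \<in> F" for A'
        using crF that B0(1) by (auto simp: cross_intersecting_def)
      have "B0 \<subseteq> {2..n}" using nsetsD[OF Y B0(1)] by auto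
      then show "B0 \<subseteq> {1..n}" "B0 \<inter> {1..<2} = {}" by auto
    qed (use nsetsD[OF F A] B0 in auto)
    define E where "E = {H \<in> nsets {1..n} k. \<exists>A\<in>F. A \<inter> H = {}}"
    have "int (card F) - int (card E) + int ((n - 1) choose k) \<le> int N - 2 * (int g - 1)"
      by (rule excess_sum_bound[OF F hit]) (use big cF in \<open>auto simp: E_def\<close>)
    moreover have "int (card E) + int (card Y) \<le> int ((n - 1) choose k)"
    proof -
      have finE: "finite E" "finite Y"
        using finite_family[of E "{1..n}" k] finite_family[OF Y] by (auto simp: E_def)
      have "E \<inter> Y = {}" using crF by (auto simp: E_def cross_intersecting_def)
      then have "card E + card Y = card (E \<union> Y)" using finE by (simp add: card_Un_disjoint)
      also have "\<dots> \<le> card (nsets {2..n} k)"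
      proof (rule card_mono)
        \<comment> \<open>Members of \<open>E\<close> miss \<open>1\<close>, since every member of
          \<open>F\<close> contains it; so \<open>E\<close> and \<open>Y\<close> compete for the
          \<open>k\<close>-subsets of only \<open>n - 1\<close> points.\<close>
        have "x \<in> {2..n}" if "H \<in> E" "x \<in> H" for H x
        proof -
          have "1 \<notin> H" "x \<in> {1..n}" using that big by (auto simp: E_def F_def nsets_iff)
          then show ?thesis using that(2) by (cases "x = 1") auto
        qed
        then have "H \<subseteq> {2..n}" if "H \<in> E" for H using that by blast
        then have "H \<in> nsets {2..n} k" if "H \<in> E" for H
          using that by (auto simp: E_def nsets_iff)
        then show "E \<union> Y \<subseteq> nsets {2..n} k" using Y by blast
      qed (simp add: finite_imp_finite_nsets)
      finally have "card E + card Y \<le> (n - 1) choose k" using nk by (simp add: card_nsets)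
      then show ?thesis by (simp only: of_nat_add[symmetric] of_nat_le_iff)
    qed
    \<comment> \<open>The two bounds add up to \<open>N - 2 * (g - 1)\<close>, which is at most
      \<open>h n k\<close> because \<open>g\<close> is positive.\<close>
    moreover have "1 \<le> int g" using g_pos by simp
    moreover have "x + y \<le> m' - u + 1"
      if "x - e + m \<le> m' - 2 * (u - 1)" "e + y \<le> m" "1 \<le> u" for x y e m m' u :: int
      using that by presburger
    ultimately show ?thesis unfolding h_eq cF by blast
  qed
qed

text \<open>A bijection onto \<open>{2..n}\<close> followed by compression preserves sizes and
  cross-intersection.\<close>

lemma sum_bound_unequal:
  fixes V :: "nat set"
  assumes V: "finite V" "card V = n - 1" and X: "X \<subseteq> nsets V (k - 1)" and Y: "Y \<subseteq> nsets V k"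
    and cr: "cross_intersecting X Y" and big: "C < card X" and ne: "Y \<noteq> {}"
  shows "int (card X) + int (card Y) \<le> h n k"
proof -
  have "card V = card {2..n}" using V nk by simp
  then obtain f where f: "bij_betw f V {2..n}" using V(1) finite_same_card_bij by blast
  then have inj: "inj_on f V" and img: "f ` V = {2..n}" by (auto simp: bij_betw_def)
  have im: "(`) f ` Z \<subseteq> nsets {2..n} q" and ca: "card ((`) f ` Z) = card Z"
    if Z: "Z \<subseteq> nsets V q" for Z q
  proof -
    show "(`) f ` Z \<subseteq> nsets {2..n} q"
    proof clarify
      fix S assume "S \<in> Z"
      then have S: "S \<subseteq> V" "finite S" "card S = q" using nsetsD[OF Z] by auto
      then have "card (f ` S) = q" using card_image[OF inj_on_subset[OF inj S(1)]] by simp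
      then show "f ` S \<in> nsets {2..n} q" using S img by (auto simp: nsets_iff)
    qed
    have "inj_on ((`) f) Z"
      by (rule inj_on_subset[OF inj_on_image_Pow[OF inj]]) (use nsetsD[OF Z] in auto)
    then show "card ((`) f ` Z) = card Z" by (rule card_image)
  qed
  have "cross_intersecting ((`) f ` X) ((`) f ` Y)"
    using cr unfolding cross_intersecting_def by blast
  then obtain X' Y' where *: "X' \<subseteq> nsets {2..n} (k - 1)" "Y' \<subseteq> nsets {2..n} k"
    "cross_intersecting X' Y'" "card X' = card X" "card Y' = card Y"
    "compressed {2..n} X'" "compressed {2..n} Y'"
    using obtain_compressed[OF _ im[OF X] im[OF Y]] ca[OF X] ca[OF Y] by (metis finite_atLeastAtMost)
  have "finite Y" using finite_family[OF Y V(1)] .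
  then have "Y' \<noteq> {}" using *(5) ne by auto
  then show ?thesis using sum_bound_compressed[OF *(1,2,3,6,7)] big * by simp
qed

end

section \<open>Splitting with respect to two elements\<close>

lemma card_link_link:
  assumes "i \<noteq> j"
  shows "card (link j (link i F)) = card {A \<in> F. i \<in> A \<and> j \<in> A}"
proof -
  have "{S \<in> link i F. j \<in> S} = link i {A \<in> F. j \<in> A}"
    using assms by (auto simp: mem_link)
  then have "card (link j (link i F)) = card (link i {A \<in> F. j \<in> A})"
    by (simp add: card_link_eq)
  also have "\<dots> = card {A \<in> F. i \<in> A \<and> j \<in> A}"
    unfolding card_link_eq by (rule arg_cong[of _ _ card]) auto
  finally show ?thesis .
qed

lemma deletion_link: "i \<noteq> j \<Longrightarrow> deletion i (link j F) = link j (deletion i F)"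
  by (auto simp: mem_link deletion_def)

lemma deletion_deletion: "deletion j (deletion i F) = {A \<in> F. i \<notin> A \<and> j \<notin> A}"
  by (auto simp: deletion_def)

lemma finite_link: "finite F \<Longrightarrow> finite (link i F)"
  by (simp add: link_def)

lemma finite_deletion: "finite F \<Longrightarrow> finite (deletion i F)"
  by (simp add: deletion_def)

lemma card_split:
  assumes "finite F"
  shows "card F = card (link j (link i F)) + card (deletion j (link i F))
    + card (link j (deletion i F)) + card (deletion j (deletion i F))"
  using card_link_deletion[OF assms, of i] card_link_deletion[OF finite_link[OF assms, of i], of j]
    card_link_deletion[OF finite_deletion[OF assms, of i], of j] by linarith

lemma deletion_not_star: "\<not> star F \<Longrightarrow> deletion i F \<noteq> {}"
  by (auto simp: star_def deletion_def)

text \<open>The point common to the shifted family must be \<open>i\<close>, since a shift adds no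
  other point to any set. So each member missing \<open>i\<close> was moved.\<close>

lemma star_shift:
  assumes "\<not> star F" "star (shift i j F)" "S \<in> F" "i \<notin> S"
  shows "j \<in> S \<and> repl i j S \<notin> F"
proof -
  obtain x where x: "\<And>T. T \<in> F \<Longrightarrow> x \<in> shift_elt i j F T"
    using assms(2) by (auto simp: star_def shift_def)
  have "x = i"
  proof (rule ccontr)
    assume "x \<noteq> i"
    then have "x \<in> T" if "T \<in> F" for T
      using x[OF that] by (auto simp: shift_elt_def repl_def split: if_splits)
    then show False using assms(1) by (auto simp: star_def)
  qed
  then show ?thesis using x[OF assms(3)] assms(4) by (auto simp: shift_elt_def split: if_splits)
qed

lemma product_le_square:
  fixes x y c :: int
  assumes "0 \<le> x" "0 \<le> y" "x + y \<le> 2 * c"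
  shows "x * y \<le> c\<^sup>2"
proof -
  have "(x + y)\<^sup>2 \<le> (2 * c)\<^sup>2" using assms by (intro power_mono) auto
  moreover have "4 * (x * y) = (x + y)\<^sup>2 - (x - y)\<^sup>2"
    by (simp add: power2_eq_square algebra_simps)
  moreover have "0 \<le> (x - y)\<^sup>2" by simp
  ultimately have "4 * (x * y) \<le> (2 * c)\<^sup>2" by linarith
  then show ?thesis by (simp add: power_mult_distrib)
qed

text \<open>In the application \<open>a\<close> and \<open>b\<close> are the two family sizes,
  \<open>c\<close> is \<open>h n k\<close>, \<open>c'\<close> is \<open>C\<close> and
  \<open>m\<close> is \<open>N\<close>.\<close>

lemma unbalanced_product:
  fixes a b c c' m :: int
  assumes "0 \<le> a" "0 \<le> b" "0 \<le> c" "b \<le> 3 * c + c' - 3 * a" "b \<le> m + c - a" "2 * c' \<le> c"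
    and "13 * c' \<le> 6 * c \<or> 11 * m \<le> 12 * c"
  shows "a * b \<le> c\<^sup>2"
proof (cases "13 * c' \<le> 6 * c")
  case True
  have "13 * b \<le> 45 * c - 39 * a" using assms True by linarith
  then have "a * (13 * b) \<le> a * (45 * c - 39 * a)" using assms by (intro mult_left_mono)
  then have 1: "13 * (a * b) \<le> 45 * (a * c) - 39 * (a * a)" by (simp add: algebra_simps)
  \<comment> \<open>Completing the square; the remainder \<open>3 * (c * c)\<close> reflects
    \<open>12 * 169 - 45 * 45 = 3\<close>.\<close>
  have "0 \<le> (78 * a - 45 * c)\<^sup>2 + 3 * (c * c)" by simp
  also have "\<dots> = 156 * (39 * (a * a) - 45 * (a * c) + 13 * (c * c))"
    by (simp add: power2_eq_square algebra_simps)
  finally have "0 \<le> 39 * (a * a) - 45 * (a * c) + 13 * (c * c)" by simp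
  then show ?thesis using 1 unfolding power2_eq_square by linarith
next
  case False
  then have m: "11 * m \<le> 12 * c" using assms by blast
  show ?thesis
  proof (rule ccontr)
    assume "\<not> ?thesis"
    then have ab: "c * c < a * b" by (simp add: power2_eq_square)
    have "2 * b \<le> 7 * c - 6 * a" using assms by linarith
    then have "a * (2 * b) \<le> a * (7 * c - 6 * a)" using assms by (intro mult_left_mono)
    then have 1: "2 * (a * b) \<le> 7 * (a * c) - 6 * (a * a)" by (simp add: algebra_simps)
    \<comment> \<open>With \<open>2 * c' \<le> c\<close> the first bound on \<open>b\<close> already
      settles \<open>3 * a \<ge> 2 * c\<close>.\<close>
    have lt: "3 * a < 2 * c"
    proof (rule ccontr)
      assume "\<not> ?thesis"
      then have "0 \<le> (2 * a - c) * (3 * a - 2 * c)"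
        using assms by (intro mult_nonneg_nonneg) linarith+
      also have "\<dots> = 6 * (a * a) - 7 * (a * c) + 2 * (c * c)" by (simp add: algebra_simps)
      finally show False using 1 ab by linarith
    qed
    have "11 * b \<le> 23 * c - 11 * a" using assms m by linarith
    then have "a * (11 * b) \<le> a * (23 * c - 11 * a)" using assms by (intro mult_left_mono)
    then have 2: "11 * (a * b) \<le> 23 * (a * c) - 11 * (a * a)" by (simp add: algebra_simps)
    \<comment> \<open>Below \<open>2 * c / 3\<close> both factors are nonnegative, so the bound on
      \<open>b\<close> through \<open>m\<close> excludes this range too.\<close>
    have "0 \<le> (2 * c - 3 * a) * (47 * c - 33 * a) + 5 * (c * c)"
      using lt assms by (intro add_nonneg_nonneg mult_nonneg_nonneg) linarith+
    also have "\<dots> = 99 * (c * c) - 207 * (a * c) + 99 * (a * a)" by (simp add: algebra_simps)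
    finally show False using 2 ab by linarith
  qed
qed

context hm_parameters
begin

text \<open>The link of each family at \<open>i\<close> cross-intersects the deletion of the other;
  add the two bounds of \<open>sum_bound_unequal\<close>.\<close>

lemma common_large_degree:
  assumes A: "A \<subseteq> nsets {1..n} k" and B: "B \<subseteq> nsets {1..n} k"
    and nt: "nontrivial_cross_intersecting A B" and i: "i \<in> {1..n}"
    and big: "C < card (link i A)" "C < card (link i B)"
  shows "int (card A) + int (card B) \<le> 2 * h n k"
proof -
  let ?V = "{1..n} - {i}"
  have V: "finite ?V" "card ?V = n - 1" using i by auto
  have cr: "cross_intersecting A B" and ns: "\<not> star A" "\<not> star B"
    using nt by (auto simp: nontrivial_cross_intersecting_def)
  have cross: "cross_intersecting (link i X) (deletion i Y)" if "cross_intersecting X Y" for X Y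
    unfolding cross_intersecting_def
  proof (intro ballI)
    fix S T assume "S \<in> link i X" "T \<in> deletion i Y"
    then have "insert i S \<in> X" "T \<in> Y" "i \<notin> T" by (auto simp: mem_link deletion_def)
    then have "insert i S \<inter> T \<noteq> {}" using crossD[OF that] by metis
    then show "S \<inter> T \<noteq> {}" using \<open>i \<notin> T\<close> by blast
  qed
  have "int (card (link i A)) + int (card (deletion i B)) \<le> h n k"
    by (rule sum_bound_unequal[OF V link_nsets[OF A] deletion_nsets[OF B] cross[OF cr] big(1)
          deletion_not_star[OF ns(2)]])
  moreover have "int (card (link i B)) + int (card (deletion i A)) \<le> h n k"
    by (rule sum_bound_unequal[OF V link_nsets[OF B] deletion_nsets[OF A] cross[OF cross_sym[OF cr]]
          big(2) deletion_not_star[OF ns(1)]])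
  ultimately show ?thesis
    using card_link_deletion[OF finite_family[OF A], of i] card_link_deletion[OF finite_family[OF B], of i]
    by simp
qed

text \<open>A set of \<open>A\<close> with \<open>i\<close> but not \<open>j\<close> and one of
  \<open>B\<close> with \<open>j\<close> but not \<open>i\<close> must meet outside
  \<open>{i, j}\<close>, so \<open>cross_sum_bound\<close> applies to \<open>n - 2\<close> points
  and rank \<open>k - 1\<close>.\<close>

lemma cross_parts:
  assumes A: "A \<subseteq> nsets {1..n} k" and B: "B \<subseteq> nsets {1..n} k" and cr: "cross_intersecting A B"
    and ij: "i \<in> {1..n}" "j \<in> {1..n}" "i \<noteq> j"
    and ne: "deletion j (link i A) \<noteq> {}" "link j (deletion i B) \<noteq> {}"
  shows "int (card (deletion j (link i A))) + int (card (link j (deletion i B))) \<le> h n k - int C"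
proof -
  let ?V = "{1..n} - {i} - {j}"
  have V: "finite ?V" "card ?V = n - 2" using ij by auto
  have "cross_intersecting (deletion j (link i A)) (link j (deletion i B))"
    unfolding cross_intersecting_def
  proof (intro ballI)
    fix S T assume "S \<in> deletion j (link i A)" "T \<in> link j (deletion i B)"
    then have "insert i S \<in> A" "j \<notin> S" "insert j T \<in> B" "i \<notin> T" "i \<noteq> j"
      using ij by (auto simp: mem_link deletion_def)
    then have "insert i S \<inter> insert j T \<noteq> {}" using crossD[OF cr] by metis
    then show "S \<inter> T \<noteq> {}" using \<open>j \<notin> S\<close> \<open>i \<notin> T\<close> \<open>i \<noteq> j\<close> by blast
  qed
  then have "card (deletion j (link i A)) + card (link j (deletion i B)) + ((card ?V - (k - 1)) choose (k - 1))
      \<le> (card ?V choose (k - 1)) + 1"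
    using V nk k3 ne deletion_nsets[OF link_nsets[OF A]] link_nsets[OF deletion_nsets[OF B]]
    by (intro cross_sum_bound) auto
  moreover have "card ?V - (k - 1) = n - k - 1" using V nk k3 by simp
  ultimately have "card (deletion j (link i A)) + card (link j (deletion i B)) + g \<le> ((n - 2) choose (k - 1)) + 1"
    using V by simp
  then have "int (card (deletion j (link i A))) + int (card (link j (deletion i B))) + int g
      \<le> int ((n - 2) choose (k - 1)) + 1"
    by (simp only: of_nat_le_iff[where 'a = int, symmetric] of_nat_add of_nat_1)
  moreover have "int N = int C + int ((n - 2) choose (k - 1))"
    by (simp only: of_nat_add[symmetric] N_split)
  moreover have "x + y \<le> N' - u + 1 - c" if "x + y + u \<le> m + 1" "N' = c + m" for x y u c m N' :: int
    using that by presburger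
  ultimately show ?thesis unfolding h_eq by blast
qed

section \<open>A shift that produces a star\<close>

text \<open>\<open>cover\<close> is what \<open>star_shift\<close> yields, and \<open>maxA\<close>
  and \<open>maxB\<close> say that neither family can be enlarged. If the sum exceeds
  \<open>2 * h n k\<close>, the shifted families supply the bounds for
  \<open>unbalanced_product\<close>.\<close>

lemma trivialising_shift:
  assumes A: "A \<subseteq> nsets {1..n} k" and B: "B \<subseteq> nsets {1..n} k"
    and nt: "nontrivial_cross_intersecting A B"
    and ij: "i \<in> {1..n}" "j \<in> {1..n}" "i \<noteq> j"
    and cover: "\<And>S. S \<in> A \<Longrightarrow> i \<notin> S \<Longrightarrow> j \<in> S \<and> repl i j S \<notin> A"
    and maxA: "\<And>S. S \<in> nsets {1..n} k \<Longrightarrow> (\<forall>T\<in>B. S \<inter> T \<noteq> {}) \<Longrightarrow> S \<in> A"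
    and maxB: "\<And>T. T \<in> nsets {1..n} k \<Longrightarrow> (\<forall>S\<in>A. S \<inter> T \<noteq> {}) \<Longrightarrow> T \<in> B"
    and big: "C < card A"
  shows "int (card A) * int (card B) \<le> (h n k)\<^sup>2"
proof (cases "int (card A) + int (card B) \<le> 2 * h n k")
  case True
  then show ?thesis by (intro product_le_square) auto
next
  case F: False
  have cr: "cross_intersecting A B" and ns: "\<not> star A" "\<not> star B"
    using nt by (auto simp: nontrivial_cross_intersecting_def)
  have fin: "finite A" "finite B" using finite_family[OF A] finite_family[OF B] by auto
  \<comment> \<open>The condition is symmetric: a replacement in \<open>A\<close> could be replaced
    back, against \<open>cover\<close>.\<close>
  have cover': "j \<notin> S \<Longrightarrow> i \<in> S \<and> repl j i S \<notin> A" if "S \<in> A" for S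
  proof
    assume "j \<notin> S"
    then show "i \<in> S" using cover that by blast
    show "repl j i S \<notin> A"
    proof
      assume R: "repl j i S \<in> A"
      moreover have "i \<notin> repl j i S" using ij by (simp add: repl_def)
      ultimately have "repl i j (repl j i S) \<notin> A" using cover by blast
      then show False using repl_inverse[OF \<open>i \<in> S\<close> \<open>j \<notin> S\<close>] that by simp
    qed
  qed
  obtain S1 where S1: "S1 \<in> A" "j \<notin> S1" using ns(1) unfolding star_def by blast
  obtain S2 where S2: "S2 \<in> A" "i \<notin> S2" using ns(1) unfolding star_def by blast
  \<comment> \<open>By maximality the missing replacement is disjoint from some \<open>T\<close> in
    \<open>B\<close>; since \<open>T\<close> meets \<open>S\<close>, it does so in \<open>y\<close>
    only.\<close>
  have witness: "\<exists>T\<in>B. y \<in> T \<and> x \<notin> T"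
    if "S \<in> A" "x \<in> {1..n}" "y \<in> S" "x \<notin> S" "repl x y S \<notin> A" for S x y
  proof -
    have r: "repl x y S \<in> nsets {1..n} k"
      by (rule repl_nsets[OF subsetD[OF A that(1)] that(2-4)])
    have "\<not> (\<forall>T\<in>B. repl x y S \<inter> T \<noteq> {})"
      by (rule contrapos_nn[OF that(5)]) (rule maxA[OF r])
    then obtain T where T: "T \<in> B" "repl x y S \<inter> T = {}" by blast
    moreover have "S \<inter> T \<noteq> {}" by (rule crossD[OF cr that(1) T(1)])
    ultimately show ?thesis by (auto simp: repl_def)
  qed
  have A10: "deletion j (link i A) \<noteq> {}"
  proof -
    have "S1 - {i} \<in> deletion j (link i A)"
      using S1 cover'[OF S1] by (simp add: deletion_def mem_link insert_absorb)
    then show ?thesis by blast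
  qed
  have A01: "link j (deletion i A) \<noteq> {}"
  proof -
    have "S2 - {j} \<in> link j (deletion i A)"
      using S2 cover[OF S2] by (simp add: deletion_def mem_link insert_absorb)
    then show ?thesis by blast
  qed
  have A00: "deletion j (deletion i A) = {}" using cover by (auto simp: deletion_def)
  have B01: "link j (deletion i B) \<noteq> {}"
  proof -
    obtain T where T: "T \<in> B" "j \<in> T" "i \<notin> T"
      using witness[OF S2(1) ij(1) _ S2(2)] cover[OF S2] by blast
    then have "T - {j} \<in> link j (deletion i B)" by (simp add: deletion_def mem_link insert_absorb)
    then show ?thesis by blast
  qed
  have B10: "deletion j (link i B) \<noteq> {}"
  proof -
    obtain T where T: "T \<in> B" "i \<in> T" "j \<notin> T"
      using witness[OF S1(1) ij(2) _ S1(2)] cover'[OF S1] by blast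
    then have "T - {i} \<in> deletion j (link i B)" by (simp add: deletion_def mem_link insert_absorb)
    then show ?thesis by blast
  qed
  \<comment> \<open>Every member of \<open>A\<close> meets \<open>{i, j}\<close>, so maximality puts
    all \<open>k\<close>-sets containing both points into \<open>B\<close>.\<close>
  have B11: "card {T \<in> B. i \<in> T \<and> j \<in> T} = C"
  proof -
    have "{T \<in> B. i \<in> T \<and> j \<in> T} = {T \<in> nsets {1..n} k. {i,j} \<subseteq> T}"
    proof (intro equalityI subsetI)
      fix T assume T: "T \<in> {T \<in> nsets {1..n} k. {i,j} \<subseteq> T}"
      have "S \<inter> T \<noteq> {}" if "S \<in> A" for S using cover[OF that] T by blast
      then show "T \<in> {T \<in> B. i \<in> T \<and> j \<in> T}" using maxB T by blast
    qed (use B in auto)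
    then show ?thesis
      using card_containing[of "{1..n}" "{i,j}" k] ij k3 by (simp add: numeral_2_eq_2)
  qed
  define a12 a1 a2 where "a12 = card {S \<in> A. i \<in> S \<and> j \<in> S}"
    and "a1 = card (deletion j (link i A))" and "a2 = card (link j (deletion i A))"
  define b1 b2 b0 where "b1 = card (deletion j (link i B))" and "b2 = card (link j (deletion i B))"
    and "b0 = card (deletion j (deletion i B))"
  have dA: "card (link i A) = a12 + a1" "card (link j A) = a12 + a2"
  proof -
    show "card (link i A) = a12 + a1"
      using card_link_deletion[OF finite_link[OF fin(1), of i], of j] card_link_link[OF ij(3), of A]
      by (simp add: a12_def a1_def)
    have "{S \<in> A. j \<in> S \<and> i \<in> S} = {S \<in> A. i \<in> S \<and> j \<in> S}" by blast
    then show "card (link j A) = a12 + a2"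
      using card_link_deletion[OF finite_link[OF fin(1), of j], of i] card_link_link[of j i A] ij
      by (simp add: a12_def a2_def deletion_link)
  qed
  have dB: "card (link i B) = C + b1" "card (link j B) = C + b2"
  proof -
    show "card (link i B) = C + b1"
      using card_link_deletion[OF finite_link[OF fin(2), of i], of j] card_link_link[OF ij(3), of B] B11
      by (simp add: b1_def)
    have "{S \<in> B. j \<in> S \<and> i \<in> S} = {S \<in> B. i \<in> S \<and> j \<in> S}" by blast
    then show "card (link j B) = C + b2"
      using card_link_deletion[OF finite_link[OF fin(2), of j], of i] card_link_link[of j i B] ij B11
      by (simp add: b2_def deletion_link)
  qed
  have pos: "0 < b1" "0 < b2"
    using B10 B01 fin by (auto simp: b1_def b2_def card_gt_0_iff intro!: finite_link finite_deletion)
  \<comment> \<open>As \<open>b1\<close> and \<open>b2\<close> are positive, the degrees of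
    \<open>B\<close> at \<open>i\<close> and \<open>j\<close> exceed \<open>C\<close>; a degree of
    \<open>A\<close> above \<open>C\<close> there would bound the sum by
    \<open>2 * h n k\<close>.\<close>
  have small: "a12 + a1 \<le> C" "a12 + a2 \<le> C"
  proof -
    show "a12 + a1 \<le> C"
    proof (rule ccontr)
      assume "\<not> ?thesis"
      then show False using common_large_degree[OF A B nt ij(1)] dA dB pos F by simp
    qed
    show "a12 + a2 \<le> C"
    proof (rule ccontr)
      assume "\<not> ?thesis"
      then show False using common_large_degree[OF A B nt ij(2)] dA dB pos F by simp
    qed
  qed
  have cA: "card A = a12 + a1 + a2"
    using card_split[OF fin(1), of j i] A00 card_link_link[OF ij(3), of A]
    by (simp add: a12_def a1_def a2_def)
  have cB: "card B = C + b1 + b2 + b0"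
    using card_split[OF fin(2), of j i] card_link_link[OF ij(3), of B] B11
    by (simp add: b0_def b1_def b2_def)
  have s1: "int a1 + int b2 \<le> h n k - int C"
    using cross_parts[OF A B cr ij A10 B01] by (simp add: a1_def b2_def)
  have s2: "int b1 + int a2 \<le> h n k - int C"
    using cross_parts[OF B A cross_sym[OF cr] ij B10 A01] by (simp add: b1_def a2_def)
  let ?V = "{1..n} - {i}"
  have V: "finite ?V" "card ?V = n - 1" using ij by auto
  \<comment> \<open>\<open>X\<close> and \<open>Y\<close> are the link and the deletion at \<open>i\<close> of the shifted families.\<close>
  define X where "X = link i A \<union> link j (deletion i A)"
  define Y where "Y = {T \<in> deletion i B. j \<in> T \<longrightarrow> repl i j T \<in> B}"
  have Xn: "X \<subseteq> nsets ?V (k - 1)"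
  proof -
    have "link j (deletion i A) \<subseteq> nsets (?V - {j}) (k - 1)"
      by (rule link_nsets[OF deletion_nsets[OF A]])
    also have "\<dots> \<subseteq> nsets ?V (k - 1)" by (rule nsets_mono) auto
    finally show ?thesis unfolding X_def using link_nsets[OF A, of i] by blast
  qed
  have Yn: "Y \<subseteq> nsets ?V k" using deletion_nsets[OF B, of i] by (auto simp: Y_def)
  \<comment> \<open>By \<open>cover\<close> no replacement lies in \<open>A\<close>, so the two
    parts do not overlap and no set is lost.\<close>
  have cX: "card X = card A"
  proof -
    have "link i A \<inter> link j (deletion i A) = {}"
    proof (rule ccontr)
      assume "\<not> ?thesis"
      then obtain Q where Q: "insert i Q \<in> A" "insert j Q \<in> A" "i \<notin> insert j Q" "j \<notin> Q"
        by (auto simp: mem_link deletion_def)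
      then have "repl i j (insert j Q) = insert i Q" by (simp add: repl_def)
      then show False using cover[OF Q(2,3)] Q(1) by simp
    qed
    then show ?thesis
      using dA cA fin by (simp add: X_def a2_def card_Un_disjoint finite_link finite_deletion)
  qed
  have crXY: "cross_intersecting X Y"
    unfolding cross_intersecting_def
  proof (intro ballI)
    fix Q T assume Q: "Q \<in> X" and T: "T \<in> Y"
    have T': "T \<in> B" "i \<notin> T" "j \<in> T \<Longrightarrow> repl i j T \<in> B"
      using T by (auto simp: Y_def deletion_def)
    consider "insert i Q \<in> A" | "insert j Q \<in> A" "i \<notin> Q" "j \<notin> Q"
      using Q by (auto simp: X_def mem_link deletion_def)
    then show "Q \<inter> T \<noteq> {}"
    proof cases
      case 1
      then have "insert i Q \<inter> T \<noteq> {}" using crossD[OF cr _ T'(1)] by metis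
      then show ?thesis using T' by blast
    next
      case 2
      show ?thesis
      proof (cases "j \<in> T")
        case True
        then have "insert j Q \<inter> repl i j T \<noteq> {}" using crossD[OF cr 2(1) T'(3)] by metis
        then show ?thesis using 2 ij by (auto simp: repl_def)
      next
        case False
        have "insert j Q \<inter> T \<noteq> {}" by (rule crossD[OF cr 2(1) T'(1)])
        then show ?thesis using False by blast
      qed
    qed
  qed
  have finY: "finite Y" using finite_family[OF Yn] by simp
  have b0Y: "b0 \<le> card Y"
    unfolding b0_def by (rule card_mono[OF finY]) (auto simp: Y_def deletion_def)
  \<comment> \<open>The members of \<open>B\<close> outside \<open>Y\<close> contain
    \<open>i\<close> after the shift, and there are only \<open>N\<close> such
    \<open>k\<close>-sets.\<close>
  have bY: "card B \<le> N + card Y"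
  proof -
    define Z where "Z = (\<lambda>T. T - {j}) ` (deletion i B - Y)"
    have inj: "inj_on (\<lambda>T. T - {j}) (deletion i B - Y)"
      by (auto simp: inj_on_def Y_def)
    have "link i B \<inter> Z = {}"
      by (auto simp: Z_def mem_link Y_def repl_def)
    moreover have "Z \<subseteq> nsets ?V (k - 1)"
    proof
      fix Q assume "Q \<in> Z"
      then obtain T where T: "T \<in> deletion i B" "T \<notin> Y" "Q = T - {j}" by (auto simp: Z_def)
      then have "j \<in> T" by (auto simp: Y_def)
      moreover have "T \<subseteq> ?V \<and> finite T \<and> card T = k" by (rule nsetsD[OF deletion_nsets[OF B] T(1)])
      ultimately show "Q \<in> nsets ?V (k - 1)" using T by (auto simp: nsets_iff)
    qed
    moreover have "finite (link i B)" "finite Z" using fin by (auto simp: Z_def finite_link finite_deletion)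
    ultimately have "card (link i B) + card Z = card (link i B \<union> Z)" "link i B \<union> Z \<subseteq> nsets ?V (k - 1)"
      using link_nsets[OF B, of i] by (simp_all add: card_Un_disjoint)
    moreover have "finite (nsets ?V (k - 1))" by (rule finite_imp_finite_nsets[OF V(1)])
    ultimately have "card (link i B) + card Z \<le> card (nsets ?V (k - 1))"
      using card_mono by metis
    then have "card (link i B) + card Z \<le> N" using V by (simp add: card_nsets)
    moreover have "card Z = card (deletion i B) - card Y"
      unfolding Z_def card_image[OF inj]
      by (rule card_Diff_subset[OF finY]) (auto simp: Y_def)
    moreover have "card B = card (link i B) + card (deletion i B)"
      by (rule card_link_deletion[OF fin(2)])
    moreover have "x \<le> m + y" if "l + z \<le> m" "z = d - y" "x = l + d" for l z m d y x :: nat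
      using that by linarith
    ultimately show ?thesis by blast
  qed
  \<comment> \<open>Add \<open>s1\<close> and \<open>s2\<close>. The first claim uses
    \<open>a12 \<le> C\<close>; the second also uses \<open>b0 \<le> card Y\<close> and
    \<open>card A + a12 \<le> 2 * C\<close>, the sum of the two bounds in
    \<open>small\<close>.\<close>
  have arith: "b0 = 0 \<Longrightarrow> int (card A) + int (card B) \<le> 2 * H"
    "int (card A) + int (card Y) \<le> H \<Longrightarrow> int (card B) \<le> 3 * H + int c - 3 * int (card A)"
    if "H = h n k" "c = C" for H c
    using b0Y cA cB s1 s2 small unfolding that[symmetric] by linarith+
  show ?thesis
  proof (cases "Y = {}")
    case True
    then have "b0 = 0" using b0Y by simp
    then have "int (card A) + int (card B) \<le> 2 * h n k" using arith(1)[OF refl refl] by blast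
    then show ?thesis using F by blast
  next
    case False
    have aY: "int (card A) + int (card Y) \<le> h n k"
      using sum_bound_unequal[OF V Xn Yn crXY _ False] big cX by simp
    show ?thesis
    proof (rule unbalanced_product)
      show "int (card B) \<le> 3 * h n k + int C - 3 * int (card A)"
        using arith(2)[OF refl refl aY] .
      show "int (card B) \<le> int N + h n k - int (card A)" using aY bY by linarith
      show "0 \<le> h n k" using two_C_le by linarith
    qed (use two_C_le h_dichotomy in auto)
  qed
qed

section \<open>Compressed families\<close>

text \<open>In a member missing \<open>1\<close>, shift some point to \<open>2\<close> if necessary,
  and then \<open>2\<close> to \<open>1\<close>.\<close>

lemma compressed_parts:
  assumes A: "A \<subseteq> nsets {1..n} k" and c: "compressed {1..n} A" and ns: "\<not> star A"
  shows "deletion 2 (link 1 A) \<noteq> {}" "link 2 (deletion 1 A) \<noteq> {}"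
proof -
  obtain S where S: "S \<in> A" "1 \<notin> S" using ns unfolding star_def by blast
  have S': "S \<subseteq> {1..n}" "card S = k" using nsetsD[OF A S(1)] by auto
  have n2: "1 \<in> {1..n}" "2 \<in> {1..n}" using nk k3 by auto
  obtain T where T: "T \<in> A" "1 \<notin> T" "2 \<in> T"
  proof (cases "2 \<in> S")
    case False
    have "S \<noteq> {}" using S' k3 by auto
    then obtain x where x: "x \<in> S" by blast
    then have "x \<in> {1..n}" "x \<noteq> 1" "x \<noteq> 2" using S S' False by auto
    then have "2 < x" "x \<in> {1..n}" by auto
    then have "repl 2 x S \<in> A" using compressedD[OF c S(1) n2(2), of x] x False by blast
    then show ?thesis using that[of "repl 2 x S"] S by (auto simp: repl_def)
  qed (use S that in blast)
  then have "T - {2} \<in> link 2 (deletion 1 A)" by (simp add: mem_link deletion_def insert_absorb)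
  then show "link 2 (deletion 1 A) \<noteq> {}" by blast
  have "repl 1 2 T \<in> A" using compressedD[OF c T(1) n2] T by simp
  then have "T - {2} \<in> deletion 2 (link 1 A)" using T by (simp add: repl_def mem_link deletion_def)
  then show "deletion 2 (link 1 A) \<noteq> {}" by blast
qed

text \<open>A member \<open>T\<close> without balanced prefix forces large excess on all of
  \<open>A\<close>. Then \<open>B\<close> avoids the set \<open>E\<close> among all
  \<open>n choose k\<close> sets, and \<open>N + N - 2 * (g - 1) = 2 * h n k\<close>.\<close>

lemma compressed_low_sum:
  assumes A: "A \<subseteq> nsets {1..n} k" and B: "B \<subseteq> nsets {1..n} k" and cr: "cross_intersecting A B"
    and c: "compressed {1..n} A" and T: "T \<in> B" "\<And>j. j \<in> {1..n} \<Longrightarrow> 2 * count T j < j"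
    and big: "C < card A"
  shows "int (card A) + int (card B) \<le> 2 * h n k"
proof -
  have hit: "\<exists>j\<in>{1..n}. j + 3 \<le> 2 * count S j" if S: "S \<in> A" for S
  proof (rule compressed_hits[OF c _ S, where B = T])
    show "S' \<inter> T \<noteq> {}" if "S' \<in> A" for S'
      using cr that T(1) unfolding cross_intersecting_def by blast
  qed (use nsetsD[OF A S] nsetsD[OF B T(1)] T in auto)
  define E where "E = {H \<in> nsets {1..n} k. \<exists>S\<in>A. S \<inter> H = {}}"
  have "int (card A) - int (card E) + int ((n - 1) choose k) \<le> int N - 2 * (int g - 1)"
    by (rule excess_sum_bound[OF A hit]) (use big in \<open>auto simp: E_def\<close>)
  moreover have "int (card E) + int (card B) \<le> int (n choose k)"
  proof -
    have "finite E" "finite B"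
      using finite_family[of E "{1..n}" k] finite_family[OF B] by (auto simp: E_def)
    moreover have "E \<inter> B = {}" using cr unfolding E_def cross_intersecting_def by blast
    ultimately have "card E + card B = card (E \<union> B)" by (simp add: card_Un_disjoint)
    also have "\<dots> \<le> card (nsets {1..n} k)"
      by (rule card_mono) (use B in \<open>auto simp: E_def finite_imp_finite_nsets\<close>)
    finally have "card E + card B \<le> n choose k" by (simp add: card_nsets)
    then show ?thesis by (simp only: of_nat_add[symmetric] of_nat_le_iff)
  qed
  moreover have "int (n choose k) = int N + int ((n - 1) choose k)"
  proof -
    obtain m r where "n = Suc m" "k = Suc r" using k3 nk by (cases n; cases k) auto
    then show ?thesis by simp
  qed
  moreover have "x + y \<le> 2 * (m' - u + 1)"
    if "x - e + m \<le> m' - 2 * (u - 1)" "e + y \<le> l" "l = m' + m" for x y e l m m' u :: int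
    using that by presburger
  ultimately show ?thesis unfolding h_eq by blast
qed

text \<open>The four traces on \<open>{1, 2}\<close> pair up: two reflection bounds contribute
  \<open>C\<close> each, two uses of \<open>cross_parts\<close> contribute \<open>h n k - C\<close>
  each.\<close>

lemma compressed_sum:
  assumes A: "A \<subseteq> nsets {1..n} k" and B: "B \<subseteq> nsets {1..n} k"
    and nt: "nontrivial_cross_intersecting A B"
    and cA: "compressed {1..n} A" and cB: "compressed {1..n} B"
    and big: "C < card A" "C < card B"
  shows "int (card A) + int (card B) \<le> 2 * h n k"
proof -
  have cr: "cross_intersecting A B" and ns: "\<not> star A" "\<not> star B"
    using nt by (auto simp: nontrivial_cross_intersecting_def)
  note cr' = cross_sym[OF cr]
  let ?low = "\<lambda>T. \<forall>j\<in>{1..n}. 2 * count T j < j"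
  consider T where "T \<in> B" "?low T" | T where "T \<in> A" "?low T"
    | "\<forall>T\<in>A \<union> B. \<exists>j\<in>{1..n}. j \<le> 2 * count T j" by (meson UnE leI)
  then show ?thesis
  proof cases
    case 1
    then show ?thesis using compressed_low_sum[OF A B cr cA 1(1) _ big(1)] by blast
  next
    case 2
    then show ?thesis using compressed_low_sum[OF B A cr' cB 2(1) _ big(2)] by fastforce
  next
    case 3
    have fin: "finite A" "finite B" using finite_family[OF A] finite_family[OF B] by auto
    have ij: "1 \<in> {1..n}" "2 \<in> {1..n}" "1 \<noteq> (2::nat)" using nk k3 by auto
    have c3: "compressed {3..n} A" "compressed {3..n} B"
      using compressed_mono[OF cA, of "{3..n}"] compressed_mono[OF cB, of "{3..n}"] by auto
    have r: "card {S \<in> X. 1 \<in> S \<and> 2 \<in> S} + card {T \<in> Y. 1 \<notin> T \<and> 2 \<notin> T} \<le> C"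
      if "X \<subseteq> nsets {1..n} k" "Y \<subseteq> nsets {1..n} k" "cross_intersecting X Y" "compressed {3..n} X"
        "Y \<subseteq> A \<union> B" for X Y
      by (rule reflection_bound[OF nk _ that(1-4)]) (use 3 that(5) k3 in auto)
    have "card (link 2 (link 1 A)) + card (deletion 2 (deletion 1 B)) \<le> C"
      "card (link 2 (link 1 B)) + card (deletion 2 (deletion 1 A)) \<le> C"
      using r[OF A B cr c3(1)] r[OF B A cr' c3(2)]
      unfolding card_link_link[OF ij(3)] deletion_deletion by auto
    moreover have "int (card (deletion 2 (link 1 A))) + int (card (link 2 (deletion 1 B))) \<le> h n k - int C"
      by (rule cross_parts[OF A B cr ij compressed_parts(1)[OF A cA ns(1)] compressed_parts(2)[OF B cB ns(2)]])
    moreover have "int (card (deletion 2 (link 1 B))) + int (card (link 2 (deletion 1 A))) \<le> h n k - int C"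
      by (rule cross_parts[OF B A cr' ij compressed_parts(1)[OF B cB ns(2)] compressed_parts(2)[OF A cA ns(1)]])
    ultimately show ?thesis
      using card_split[OF fin(1), of 2 1] card_split[OF fin(2), of 2 1] by linarith
  qed
qed

section \<open>The extremal counterexample\<close>

definition counterexample :: "nat set set \<Rightarrow> nat set set \<Rightarrow> bool" where
  "counterexample A B \<longleftrightarrow> A \<subseteq> nsets {1..n} k \<and> B \<subseteq> nsets {1..n} k \<and>
    nontrivial_cross_intersecting A B \<and> (h n k)\<^sup>2 < int (card A) * int (card B)"

lemma counterexample_commute: "counterexample A B \<Longrightarrow> counterexample B A"
  by (auto simp: counterexample_def nontrivial_cross_intersecting_def cross_commute mult.commute)

lemma counterexample_extend:
  assumes ce: "counterexample A B" and S: "S \<in> nsets {1..n} k" "\<forall>T\<in>B. S \<inter> T \<noteq> {}"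
  shows "counterexample (insert S A) B"
proof -
  have fin: "finite A" using ce finite_family unfolding counterexample_def by blast
  have "int (card A) * int (card B) \<le> int (card (insert S A)) * int (card B)"
    using fin by (intro mult_right_mono) (auto simp: card_insert_if)
  then show ?thesis
    using ce S by (auto simp: counterexample_def nontrivial_cross_intersecting_def
        cross_intersecting_def star_def)
qed

lemma counterexample_big:
  assumes "counterexample A B"
  shows "C < card A"
proof (rule ccontr)
  assume "\<not> ?thesis"
  then show False
    using nontrivial_small_product[of A B] assms
    by (auto simp: counterexample_def nontrivial_cross_intersecting_def)
qed

text \<open>In a counterexample of maximal total size no set can be added to either family, which
  provides the saturation hypotheses of \<open>trivialising_shift\<close>.\<close>

lemma counterexample_shift:
  assumes ce: "counterexample A B"
    and max: "\<And>A' B'. counterexample A' B' \<Longrightarrow> card A' + card B' \<le> card A + card B"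
    and ij: "i \<in> {1..n}" "j \<in> {1..n}" "i \<noteq> j"
  shows "\<not> star (shift i j A)"
proof
  assume st: "star (shift i j A)"
  have sub: "A \<subseteq> nsets {1..n} k" "B \<subseteq> nsets {1..n} k" and nt: "nontrivial_cross_intersecting A B"
    using ce by (auto simp: counterexample_def)
  have fin: "finite A" "finite B" using finite_family[OF sub(1)] finite_family[OF sub(2)] by auto
  have "S \<in> A" if "S \<in> nsets {1..n} k" "\<forall>T\<in>B. S \<inter> T \<noteq> {}" for S
    using max[OF counterexample_extend[OF ce that]] fin by (auto simp: card_insert_if split: if_splits)
  moreover have "T \<in> B" if "T \<in> nsets {1..n} k" "\<forall>S\<in>A. S \<inter> T \<noteq> {}" for T
    using max[OF counterexample_commute[OF counterexample_extend[OF counterexample_commute[OF ce], of T]]]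
      that fin by (auto simp: card_insert_if Int_commute split: if_splits)
  moreover have "\<not> star A" using nt by (simp add: nontrivial_cross_intersecting_def)
  ultimately have "int (card A) * int (card B) \<le> (h n k)\<^sup>2"
    using star_shift[OF _ st] counterexample_big[OF ce]
    by (intro trivialising_shift[OF sub nt ij]) auto
  then show False using ce by (simp add: counterexample_def)
qed

lemma no_counterexample: "\<not> counterexample A B"
proof
  assume ce: "counterexample A B"
  let ?P = "\<lambda>(A, B). counterexample A B" and ?size = "\<lambda>(A, B). card A + card B"
  have bound: "\<forall>p. ?P p \<longrightarrow> ?size p < Suc (2 * (n choose k))"
  proof clarify
    fix A B assume "counterexample A B"
    then have "A \<subseteq> nsets {1..n} k" "B \<subseteq> nsets {1..n} k" by (simp_all add: counterexample_def)
    moreover have "finite (nsets {1..n} k)" by (rule finite_imp_finite_nsets) simp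
    ultimately have "card A \<le> card (nsets {1..n} k)" "card B \<le> card (nsets {1..n} k)"
      using card_mono by metis+
    then show "card A + card B < Suc (2 * (n choose k))" by (simp add: card_nsets)
  qed
  have "?P (A,B)" using ce by simp
  then have "\<exists>p. ?P p \<and> (\<forall>q. ?P q \<longrightarrow> ?size q \<le> ?size p)"
    using bound by (rule Lattices_Big.ex_has_greatest_nat[where P = ?P and f = ?size])
  then obtain p where p: "?P p" "\<And>q. ?P q \<Longrightarrow> ?size q \<le> ?size p" by blast
  obtain A1 B1 where p_eq: "p = (A1, B1)" by (cases p)
  have ce1: "counterexample A1 B1" using p(1) unfolding p_eq by simp
  have max1: "card A' + card B' \<le> card A1 + card B1" if "counterexample A' B'" for A' B'
    using p(2)[of "(A', B')"] that unfolding p_eq by simp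
  \<comment> \<open>Second extremal choice: least weight among the counterexamples of maximal total
    size.\<close>
  let ?Q = "\<lambda>(A, B). counterexample A B \<and> card A + card B = card A1 + card B1"
    and ?weight = "\<lambda>(A, B). weight A + weight B"
  have "?Q (A1,B1)" using ce1 by simp
  then have "\<exists>p. ?Q p \<and> (\<forall>q. ?Q q \<longrightarrow> ?weight p \<le> ?weight q)"
    by (rule ex_has_least_nat[where P = ?Q and m = ?weight])
  then obtain q where q: "?Q q" "\<And>r. ?Q r \<Longrightarrow> ?weight q \<le> ?weight r" by blast
  obtain A2 B2 where q_eq: "q = (A2, B2)" by (cases q)
  have ce2: "counterexample A2 B2" "card A2 + card B2 = card A1 + card B1"
    using q(1) unfolding q_eq by simp_all
  have least: "weight A2 + weight B2 \<le> weight A' + weight B'"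
    if "counterexample A' B'" "card A' + card B' = card A1 + card B1" for A' B'
    using q(2)[of "(A', B')"] that unfolding q_eq by simp
  note ce2' = counterexample_commute[OF ce2(1)]
  have max: "card A' + card B' \<le> card A2 + card B2" if "counterexample A' B'" for A' B'
    using max1[OF that] ce2(2) by simp
  have sub: "A2 \<subseteq> nsets {1..n} k" "B2 \<subseteq> nsets {1..n} k"
    and nt: "nontrivial_cross_intersecting A2 B2"
    using ce2 by (auto simp: counterexample_def)
  have fin: "finite A2" "finite B2" using finite_family[OF sub(1)] finite_family[OF sub(2)] by auto
  have finm: "finite S" if "S \<in> A2 \<union> B2" for S using nsetsD[OF sub(1)] nsetsD[OF sub(2)] that by blast
  have fixed: "shift i j A2 = A2 \<and> shift i j B2 = B2" if ij: "i \<in> {1..n}" "j \<in> {1..n}" "i < j" for i j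
  proof -
    have "\<not> star (shift i j A2)"
      by (rule counterexample_shift[OF ce2(1) max]) (use ij in auto)
    moreover have "\<not> star (shift i j B2)"
    proof (rule counterexample_shift[OF ce2'])
      show "card A' + card B' \<le> card B2 + card A2" if "counterexample A' B'" for A' B'
        using max[OF counterexample_commute[OF that]] by simp
    qed (use ij in auto)
    \<comment> \<open>As neither shifted family is a star, the shifted pair is again a
      counterexample of the same size, so minimality of the weight allows no set to move.\<close>
    ultimately have "counterexample (shift i j A2) (shift i j B2)"
      using ce2(1) ij shift_nsets[OF sub(1), of i j] shift_nsets[OF sub(2), of i j]
      by (auto simp: counterexample_def nontrivial_cross_intersecting_def card_shift intro: cross_shift)
    from least[OF this] have "weight A2 + weight B2 \<le> weight (shift i j A2) + weight (shift i j B2)"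
      using ce2(2) by (simp add: card_shift)
    then show ?thesis
      using weight_shift[OF ij(3) fin(1)] weight_shift[OF ij(3) fin(2)] finm by fastforce
  qed
  have comp: "compressed {1..n} A2" "compressed {1..n} B2"
    using fixed by (auto intro!: compressedI)
  have "int (card A2) + int (card B2) \<le> 2 * h n k"
    by (rule compressed_sum[OF sub nt comp counterexample_big[OF ce2(1)] counterexample_big[OF ce2']])
  then have "int (card A2) * int (card B2) \<le> (h n k)\<^sup>2" by (intro product_le_square) auto
  then show False using ce2(1) by (simp add: counterexample_def)
qed

end

theorem theorem1p4:
  fixes n k :: nat and \<A> \<B> :: "nat set set"
  assumes "k \<ge> 3" and "n \<ge> 2 * k"
    and "\<A> \<subseteq> nsets {1..n} k" and "\<B> \<subseteq> nsets {1..n} k"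
    and "nontrivial_cross_intersecting \<A> \<B>"
  shows "int (card \<A>) * int (card \<B>) \<le> (h n k)\<^sup>2"
proof -
  interpret hm_parameters n k using assms by unfold_locales
  show ?thesis using no_counterexample[of \<A> \<B>] assms(3-5) by (simp add: counterexample_def)
qed
end
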